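(* Let $\alpha$ be an irrational real number. For real $\beta$ put $\mathcal M_+(\alpha,\beta)=\liminf_{q\to\infty} q\,\|q\alpha-\beta\|$, where $q$ runs over positive integers, and let $\mathcal S_+(\alpha)=\{\mathcal M_+(\alpha,\beta):\beta\in\mathbf R^+\}$. Then there exists $\mu_\alpha>0$ such that the interval $[0,\mu_\alpha]$ is contained in $\mathcal S_+(\alpha)$.
   Context: $\|x\|$ denotes the distance from the real number $x$ to the nearest integer. *)

theory Defs
  imports Complex_Main "HOL-Library.Extended_Real"
begin

definition dist_nearest_int :: "real \<Rightarrow> real" where
  "dist_nearest_int x = \<bar>x - of_int (round x)\<bar>"

text \<open>
  The lower limit is taken in the extended reals, where it always exists.  The index
  \<open>q\<close> ranges over all naturals; the single extra index \<open>0\<close> has no influence on the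
  lower limit.
\<close>

definition M_plus :: "real \<Rightarrow> real \<Rightarrow> ereal" where
  "M_plus \<alpha> \<beta> =
     liminf (\<lambda>q::nat. ereal (real q * dist_nearest_int (real q * \<alpha> - \<beta>)))"

definition S_plus :: "real \<Rightarrow> ereal set" where
  "S_plus \<alpha> = {M_plus \<alpha> \<beta> | \<beta>. \<beta> > 0}"

end

theory Submission
  imports Defs "HOL-Analysis.Kronecker_Approximation_Theorem"
begin

text \<open>
  A target \<open>\<beta>\<close> is built by successive corrections: given a point that all late orbit
  points \<open>q\<alpha>\<close> avoid (that is, \<open>q \<parallel>q\<alpha> - \<beta>\<parallel> \<ge> c'\<close>), one moves it slightly so that a single further
  \<open>q\<close> gives \<open>q \<parallel>q\<alpha> - \<beta>\<parallel> \<approx> c\<close>, no other \<open>q\<close> gives less than \<open>c\<close>, and all late points avoid it again.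
  Writing \<open>\<beta> = q\<alpha> + y\<close> with \<open>y \<approx> c/q\<close>, the earlier orbit points restrict \<open>q\<close> and the later ones restrict \<open>y\<close>.

  If \<open>\<alpha>\<close> is badly approximable, both restrictions are sparse families of forbidden intervals for the
  one real parameter \<open>s = q = c/y\<close>, so a nested interval argument meets both at once.
  Otherwise there are denominators \<open>n\<close> with \<open>\<delta> = \<parallel>n\<alpha>\<parallel>\<close> minute compared with \<open>1/n\<close>.  Then \<open>y\<close>, a small multiple of
  \<open>\<delta>\<close>, can be chosen first, and \<open>q = r + jn\<close> with \<open>j\<close> free makes \<open>qy\<close> as close to \<open>c\<close> as desired.
\<close>

subsection \<open>Distance to the nearest integer\<close>

text \<open>Restricting to positive indices creates an asymmetry. An index i = q + n after the hit
  carries a weight larger than both q and n, but an index i = q - n before it may carry a small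
  weight exactly where \<parallel>n\<alpha>\<parallel> is tiny. Two protections have to overlap
  there. Moving \<beta> by D costs the index i at most i D, so the old bound c' survives, up to a
  constant factor, only for i below about c'/D. Larger i must be protected by the arithmetic of
  \<parallel>(q - i)\<alpha>\<parallel>, which offers only a level c far below c'. This is why two
  constants occur and why c' has to be restored from scratch after each hit. For badly approximable
  \<alpha> one has D of order 1/(\<kappa>L), with L the length of the range in which q is chosen,
  and the overlap leads to \<mu> = \<kappa>^3/10^10. In the other case the constants c' and \<mu>
  are absolute.\<close>

notation dist_nearest_int (\<open>\<parallel>_\<parallel>\<close>)

lemma dist_nearest_int_le: "\<parallel>x\<parallel> \<le> \<bar>x - of_int k\<bar>"
  unfolding dist_nearest_int_def using round_diff_minimal by blast

lemma dist_nearest_int_ex: "\<exists>k. \<parallel>x\<parallel> = \<bar>x - of_int k\<bar>"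
  unfolding dist_nearest_int_def by blast

lemma dist_nearest_int_nonneg [simp]: "0 \<le> \<parallel>x\<parallel>"
  unfolding dist_nearest_int_def by simp

lemma dist_nearest_int_le_abs: "\<parallel>x\<parallel> \<le> \<bar>x\<bar>"
  using dist_nearest_int_le[of x 0] by simp

lemma dist_nearest_int_triangle: "\<parallel>x + y\<parallel> \<le> \<parallel>x\<parallel> + \<parallel>y\<parallel>"
proof -
  obtain k l where "\<parallel>x\<parallel> = \<bar>x - of_int k\<bar>" "\<parallel>y\<parallel> = \<bar>y - of_int l\<bar>"
    using dist_nearest_int_ex by meson
  moreover have "\<parallel>x + y\<parallel> \<le> \<bar>x + y - of_int (k + l)\<bar>" by (rule dist_nearest_int_le)
  ultimately show ?thesis by simp
qed

lemma dist_nearest_int_minus [simp]: "\<parallel>- x\<parallel> = \<parallel>x\<parallel>"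
proof -
  have le: "\<parallel>- y\<parallel> \<le> \<parallel>y\<parallel>" for y
  proof -
    obtain k where "\<parallel>y\<parallel> = \<bar>y - of_int k\<bar>" using dist_nearest_int_ex by blast
    then show ?thesis using dist_nearest_int_le[of "- y" "- k"] by simp
  qed
  from le[of x] le[of "- x"] show ?thesis by simp
qed

lemma dist_nearest_int_triangle_diff: "\<parallel>x - y\<parallel> \<le> \<parallel>x\<parallel> + \<parallel>y\<parallel>"
  using dist_nearest_int_triangle[of x "- y"] by simp

lemma dist_nearest_int_add_of_int [simp]: "\<parallel>x + of_int k\<parallel> = \<parallel>x\<parallel>"
proof -
  have le: "\<parallel>y + of_int k\<parallel> \<le> \<parallel>y\<parallel>" for y k
  proof -
    obtain l where "\<parallel>y\<parallel> = \<bar>y - of_int l\<bar>" using dist_nearest_int_ex by blast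
    then show ?thesis using dist_nearest_int_le[of "y + of_int k" "l + k"] by simp
  qed
  from le[of x k] le[of "x + of_int k" "- k"] show ?thesis by simp
qed

lemma dist_nearest_int_cong: "x - y = of_int k \<Longrightarrow> \<parallel>x\<parallel> = \<parallel>y\<parallel>"
  using dist_nearest_int_add_of_int[of y k] by (simp add: algebra_simps)

lemma dist_nearest_int_add_ge: "\<parallel>x\<parallel> - \<bar>y\<bar> \<le> \<parallel>x + y\<parallel>"
  using dist_nearest_int_triangle[of "x + y" "- y"] dist_nearest_int_le_abs[of "- y"] by simp

lemma dist_nearest_int_diff_ge: "\<parallel>x\<parallel> - \<bar>x - y\<bar> \<le> \<parallel>y\<parallel>"
  using dist_nearest_int_add_ge[of x "y - x"] by simp

lemma dist_nearest_int_eq_abs: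
  assumes "\<bar>x\<bar> \<le> 1/2" shows "\<parallel>x\<parallel> = \<bar>x\<bar>"
proof (rule antisym[OF dist_nearest_int_le_abs])
  obtain k where k: "\<parallel>x\<parallel> = \<bar>x - of_int k\<bar>" using dist_nearest_int_ex by blast
  show "\<bar>x\<bar> \<le> \<parallel>x\<parallel>"
  proof (cases "k = 0")
    case False
    then have "1 \<le> \<bar>real_of_int k\<bar>" by linarith
    then show ?thesis unfolding k using assms by linarith
  qed (simp add: k)
qed

lemma dist_nearest_int_mult_le: "\<parallel>of_int n * x\<parallel> \<le> \<bar>of_int n\<bar> * \<parallel>x\<parallel>"
proof -
  obtain k where k: "\<parallel>x\<parallel> = \<bar>x - of_int k\<bar>" using dist_nearest_int_ex by blast
  have "\<parallel>of_int n * x\<parallel> \<le> \<bar>of_int n * x - of_int (n * k)\<bar>" by (rule dist_nearest_int_le)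
  also have "\<dots> = \<bar>of_int n * (x - of_int k)\<bar>" by (simp add: algebra_simps)
  finally show ?thesis by (simp add: k abs_mult)
qed

lemma dist_nearest_int_pos:
  assumes "\<alpha> \<notin> \<rat>" "t \<noteq> 0" shows "0 < \<parallel>of_int t * \<alpha>\<parallel>"
proof (rule ccontr)
  assume "\<not> ?thesis"
  then have "\<parallel>of_int t * \<alpha>\<parallel> = 0" using dist_nearest_int_nonneg[of "of_int t * \<alpha>"] by linarith
  then obtain k where "of_int t * \<alpha> = of_int k" using dist_nearest_int_ex[of "of_int t * \<alpha>"] by auto
  then have "\<alpha> = of_int k / of_int t" using assms(2) by (simp add: field_simps)
  then show False using assms(1) by auto
qed

lemma abs_of_int_nonzero_ge_1: "k \<noteq> 0 \<Longrightarrow> 1 \<le> \<bar>real_of_int k\<bar>"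
  by linarith

text \<open>As p/n is reduced, n(t\<alpha> - k) is a nonzero integer plus an error of at most 1/2.
  With \<open>dist_nearest_int_dvd\<close> this gives a dichotomy: multiples of n see exact
  multiples of |n\<alpha> - p|, all other t stay 1/(2n) away from the integers.\<close>

lemma dist_nearest_int_not_dvd:
  fixes n p t :: int and \<alpha> :: real
  assumes "coprime n p" "n > 0" "\<not> n dvd t" and t: "\<bar>of_int t\<bar> * \<bar>of_int n * \<alpha> - of_int p\<bar> \<le> 1/2"
  shows "1 / (2 * of_int n) \<le> \<parallel>of_int t * \<alpha>\<parallel>"
proof -
  obtain k where k: "\<parallel>of_int t * \<alpha>\<parallel> = \<bar>of_int t * \<alpha> - of_int k\<bar>" using dist_nearest_int_ex by blast
  have "t * p - n * k \<noteq> 0"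
  proof
    assume "t * p - n * k = 0"
    then have "n dvd t * p" by simp
    with assms(1,3) show False by (simp add: coprime_dvd_mult_left_iff)
  qed
  then have 1: "1 \<le> \<bar>real_of_int (t * p - n * k)\<bar>" by (rule abs_of_int_nonzero_ge_1)
  have "of_int n * (of_int t * \<alpha> - of_int k) = of_int t * (of_int n * \<alpha> - of_int p) + real_of_int (t * p - n * k)"
    by (simp add: algebra_simps)
  moreover have "\<bar>of_int t * (of_int n * \<alpha> - of_int p)\<bar> \<le> 1/2" using t by (simp add: abs_mult)
  ultimately have "1/2 \<le> \<bar>of_int n * (of_int t * \<alpha> - of_int k)\<bar>" using 1 by linarith
  then have "1/2 \<le> of_int n * \<bar>of_int t * \<alpha> - of_int k\<bar>" using assms(2) by (simp add: abs_mult)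
  then have "1/2 / of_int n \<le> \<bar>of_int t * \<alpha> - of_int k\<bar>" using assms(2)
    by (subst pos_divide_le_eq) (simp_all add: mult.commute)
  then show ?thesis unfolding k by simp
qed

lemma dist_nearest_int_dvd:
  fixes n p i :: int and \<alpha> :: real
  assumes "\<bar>of_int i\<bar> * \<bar>of_int n * \<alpha> - of_int p\<bar> \<le> 1/2"
  shows "\<parallel>of_int (n * i) * \<alpha>\<parallel> = \<bar>of_int i\<bar> * \<bar>of_int n * \<alpha> - of_int p\<bar>"
proof -
  have "\<parallel>of_int (n * i) * \<alpha>\<parallel> = \<parallel>of_int i * (of_int n * \<alpha> - of_int p)\<parallel>"
    by (rule dist_nearest_int_cong[of _ _ "i * p"]) (simp add: algebra_simps)
  also have "\<dots> = \<bar>of_int i * (of_int n * \<alpha> - of_int p)\<bar>"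
    using assms by (intro dist_nearest_int_eq_abs) (simp add: abs_mult)
  finally show ?thesis by (simp add: abs_mult)
qed

text \<open>Over n consecutive r the points r p/n meet every class of the grid of mesh 1/n. Rounding
  the target to the grid costs 1/n, and using \<alpha> in place of p/n inside the block costs at
  most |n\<alpha> - p|.\<close>

lemma inhomogeneous_approx_in_block:
  fixes n p A :: int and \<alpha> x :: real
  assumes "coprime n p" "n > 0"
  obtains r k where "A \<le> r" "r < A + n"
    "\<bar>of_int r * \<alpha> - of_int k - x\<bar> \<le> 1 / of_int n + \<bar>of_int n * \<alpha> - of_int p\<bar>"
proof -
  define z where "z = of_int n * (x - of_int A * \<alpha>)"
  define u where "u = \<lfloor>z\<rfloor>"
  obtain a b where ab: "a * n + b * p = 1"
    using bezout_int[of n p] assms(1) by auto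
  \<comment> \<open>The Bezout coefficient b inverts p modulo n, so \<open>s\<close> solves p s
    \<equiv> u (mod n); \<open>u\<close> is the target relative to A\<alpha>, scaled by n and
    rounded down.\<close>
  define s where "s = (b * u) mod n"
  define v where "v = - a * u - p * ((b * u) div n)"
  have "p * s = p * (b * u - n * ((b * u) div n))"
    by (simp add: s_def minus_mult_div_eq_mod)
  also have "\<dots> = (a * n + b * p) * u + n * v" by (simp add: v_def algebra_simps)
  finally have v: "p * s = u + n * v" by (simp add: ab)
  have s: "0 \<le> s" "s < n" using assms(2) by (auto simp: s_def)
  define e where "e = \<bar>of_int n * \<alpha> - of_int p\<bar>"
  have "of_int n * (of_int (A + s) * \<alpha> - of_int v - x)
     = of_int s * (of_int n * \<alpha> - of_int p) + real_of_int (p * s - n * v) - z"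
    by (simp add: z_def algebra_simps)
  also have "\<dots> = of_int s * (of_int n * \<alpha> - of_int p) + (of_int u - z)" using v by simp
  finally have "\<bar>of_int n * (of_int (A + s) * \<alpha> - of_int v - x)\<bar>
      \<le> \<bar>of_int s * (of_int n * \<alpha> - of_int p)\<bar> + \<bar>of_int u - z\<bar>" by linarith
  also have "\<bar>of_int u - z\<bar> \<le> 1" unfolding u_def by linarith
  also have "\<bar>of_int s * (of_int n * \<alpha> - of_int p)\<bar> \<le> of_int n * e"
    unfolding e_def abs_mult using s by (intro mult_right_mono) auto
  finally have "of_int n * \<bar>of_int (A + s) * \<alpha> - of_int v - x\<bar> \<le> of_int n * e + 1"
    using assms(2) by (simp add: abs_mult)
  then have "\<bar>of_int (A + s) * \<alpha> - of_int v - x\<bar> \<le> 1 / of_int n + e"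
    using assms(2) by (simp add: field_simps)
  then show ?thesis using that[of "A + s" v] s by (simp add: e_def)
qed

lemma dirichlet_coprime_int:
  fixes \<alpha> X :: real assumes "X \<ge> 1"
  obtains n p :: int where "coprime n p" "0 < n" "of_int n \<le> X" "\<bar>of_int n * \<alpha> - of_int p\<bar> < 2 / X"
proof -
  define N where "N = nat \<lfloor>X\<rfloor>"
  have N: "N > 0" "real N \<le> X" "X < real N + 1" using assms unfolding N_def by linarith+
  obtain h k where hk: "coprime h k" "0 < k" "k \<le> int N" "\<bar>of_int k * \<alpha> - of_int h\<bar> < 1 / N"
    using Dirichlet_approx_coprime[OF N(1), of \<alpha>] by blast
  have "1 / real N \<le> 2 / X" using N by (simp add: field_simps)
  moreover have "of_int k \<le> X" using hk(3) N(2) by linarith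
  ultimately show ?thesis using hk by (intro that[of k h]) (auto simp: coprime_commute)
qed

lemma dist_nearest_int_bounded_below:
  assumes "\<alpha> \<notin> \<rat>"
  obtains d where "d > 0" "\<And>t::int. 1 \<le> t \<Longrightarrow> of_int t \<le> (X::real) \<Longrightarrow> d \<le> \<parallel>of_int t * \<alpha>\<parallel>"
proof -
  \<comment> \<open>The inserted 1 keeps the set nonempty when X < 1.\<close>
  define d where "d = Min (insert 1 ((\<lambda>t. \<parallel>of_int t * \<alpha>\<parallel>) ` {1..\<lfloor>X\<rfloor>}))"
  have "d > 0" unfolding d_def using dist_nearest_int_pos[OF assms] by (subst Min_gr_iff) auto
  moreover have "d \<le> \<parallel>of_int t * \<alpha>\<parallel>" if "1 \<le> t" "of_int t \<le> X" for t :: int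
    unfolding d_def using that by (intro Min_le) (auto simp: le_floor_iff)
  ultimately show ?thesis using that by blast
qed

lemma power_bracket:
  fixes x R :: real assumes "x \<ge> 1" "R > 1"
  obtains i where "R ^ i \<le> x" "x < R ^ Suc i"
proof -
  define j where "j = (LEAST j. x < R ^ j)"
  have ex: "\<exists>j. x < R ^ j" using assms(2) real_arch_pow by blast
  have j: "x < R ^ j" unfolding j_def by (rule LeastI_ex[OF ex])
  then have "j \<noteq> 0" using assms(1) by (auto intro: ccontr)
  then obtain i where i: "j = Suc i" using not0_implies_Suc by blast
  have "\<not> x < R ^ i" using not_less_Least[of i "\<lambda>j. x < R ^ j"] i unfolding j_def by simp
  then show ?thesis using j i that[of i] by simp
qed

subsection \<open>Nested interval games\<close>

text \<open>Pigeonhole: \<open>card F + 1\<close> candidates of length l start 3l apart. The gaps of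
  length 2l exceed the diameter of each trace, so a set of F spoils at most one candidate.\<close>

lemma subinterval_avoiding_finite:
  fixes a l :: real and R :: nat
  assumes "l > 0" "finite F" "3 * card F + 1 \<le> R"
    and diam: "\<And>W x y. W \<in> F \<Longrightarrow> x \<in> W \<Longrightarrow> y \<in> W \<Longrightarrow> x \<in> {a..a + real R * l} \<Longrightarrow> y \<in> {a..a + real R * l} \<Longrightarrow> \<bar>x - y\<bar> \<le> l"
  obtains b where "a \<le> b" "b + l \<le> a + real R * l" "\<And>W x. W \<in> F \<Longrightarrow> x \<in> {b..b + l} \<Longrightarrow> x \<notin> W"
proof -
  define I where "I k = {a + 3 * real k * l .. a + 3 * real k * l + l}" for k :: nat
  have sub: "I k \<subseteq> {a..a + real R * l}" if "k \<le> card F" for k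
  proof -
    have "3 * real k + 1 \<le> real R" using that assms(3) by linarith
    then have "(3 * real k + 1) * l \<le> real R * l" using assms(1) by (intro mult_right_mono) auto
    then show ?thesis unfolding I_def using assms(1) by (auto simp: algebra_simps intro: order_trans)
  qed
  have "\<exists>k \<le> card F. \<forall>W\<in>F. I k \<inter> W = {}"
  proof (rule ccontr)
    assume "\<not> ?thesis"
    then have "\<forall>k\<in>{..card F}. \<exists>W. W \<in> F \<and> I k \<inter> W \<noteq> {}" by (simp add: Bex_def)
    then obtain g where g: "\<And>k. k \<le> card F \<Longrightarrow> g k \<in> F \<and> I k \<inter> g k \<noteq> {}" 
      unfolding atMost_iff Ball_def by metis
    have "\<not> inj_on g {..card F}"
    proof
      assume "inj_on g {..card F}"
      then have "card {..card F} \<le> card F" using g assms(2) by (intro card_inj_on_le[of g]) auto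
      then show False by simp
    qed
    then obtain i k where ik: "i \<le> card F" "k \<le> card F" "g i = g k" "i < k"
      unfolding inj_on_def by (metis atMost_iff linorder_neqE_nat)
    obtain x y where x: "x \<in> I i" "x \<in> g i" and y: "y \<in> I k" "y \<in> g i" using g[OF ik(1)] g[OF ik(2)] ik(3) by auto
    have "\<bar>x - y\<bar> \<le> l" using diam[of "g i" x y] g[OF ik(1)] x y sub[OF ik(1)] sub[OF ik(2)] by blast
    moreover have "3 * (real i + 1) * l \<le> 3 * real k * l" using ik(4) assms(1) by (intro mult_right_mono) auto
    ultimately show False using x y assms(1) unfolding I_def by (auto simp: algebra_simps)
  qed
  then obtain k where k: "k \<le> card F" "\<forall>W\<in>F. I k \<inter> W = {}" by blast
  show ?thesis
  proof (rule that[of "a + 3 * real k * l"])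
    show "a \<le> a + 3 * real k * l" using assms(1) by simp
    show "a + 3 * real k * l + l \<le> a + real R * l" using sub[OF k(1)] assms(1) unfolding I_def by auto
    show "x \<notin> W" if "W \<in> F" "x \<in> {a + 3 * real k * l..a + 3 * real k * l + l}" for W x
      using k(2) that unfolding I_def by blast
  qed
qed

text \<open>Finite stages are kept apart from the limit point because
  \<open>hit_scale_interval\<close> stops after m rounds: it needs a whole surviving interval, in
  which an integer q can still be chosen.\<close>

lemma nested_interval_game:
  fixes l :: "nat \<Rightarrow> real" and G :: "nat \<Rightarrow> real \<Rightarrow> bool"
  assumes l: "\<And>i. l i \<ge> 0"
    and step: "\<And>i b. a \<le> b \<Longrightarrow> b + l i \<le> a + l 0 \<Longrightarrow>
      \<exists>b'. b \<le> b' \<and> b' + l (Suc i) \<le> b + l i \<and> (\<forall>x\<in>{b'..b' + l (Suc i)}. G i x)"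
  obtains b where "\<And>i. a \<le> b i" "\<And>i. b i + l i \<le> a + l 0"
    "\<And>i j x. i < j \<Longrightarrow> x \<in> {b j..b j + l j} \<Longrightarrow> G i x" "\<And>i j. i \<le> j \<Longrightarrow> b i \<le> b j \<and> b j + l j \<le> b i + l i"
proof -
  obtain b where b: "\<And>i. a \<le> b i \<and> b i + l i \<le> a + l 0"
     "\<And>i. b i \<le> b (Suc i) \<and> b (Suc i) + l (Suc i) \<le> b i + l i \<and> (\<forall>x\<in>{b (Suc i)..b (Suc i) + l (Suc i)}. G i x)"
  proof (atomize_elim, rule exE[OF dependent_nat_choice[of "\<lambda>i b. a \<le> b \<and> b + l i \<le> a + l 0"
     "\<lambda>i b b'. b \<le> b' \<and> b' + l (Suc i) \<le> b + l i \<and> (\<forall>x\<in>{b'..b' + l (Suc i)}. G i x)"]])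
    show "\<exists>b. a \<le> b \<and> b + l 0 \<le> a + l 0" by auto
  next
    fix x n assume "a \<le> x \<and> x + l n \<le> a + l 0"
    then show "\<exists>y. (a \<le> y \<and> y + l (Suc n) \<le> a + l 0) \<and> x \<le> y \<and> y + l (Suc n) \<le> x + l n \<and> (\<forall>x\<in>{y..y + l (Suc n)}. G n x)"
      using step[of x n] by (meson order_trans)
  qed auto
  have nest: "b i \<le> b j \<and> b j + l j \<le> b i + l i" if "i \<le> j" for i j
    using that
  proof (induction rule: dec_induct)
    case (step k)
    then show ?case using b(2)[of k] by linarith
  qed simp
  show ?thesis
  proof (rule that[of b])
    show "G i x" if "i < j" "x \<in> {b j..b j + l j}" for i j x
      using b(2)[of i] nest[of "Suc i" j] that by auto
  qed (use b(1) nest in auto)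
qed

lemma nested_interval_game_limit:
  fixes l :: "nat \<Rightarrow> real" and G :: "nat \<Rightarrow> real \<Rightarrow> bool"
  assumes l: "\<And>i. l i \<ge> 0"
    and step: "\<And>i b. a \<le> b \<Longrightarrow> b + l i \<le> a + l 0 \<Longrightarrow>
      \<exists>b'. b \<le> b' \<and> b' + l (Suc i) \<le> b + l i \<and> (\<forall>x\<in>{b'..b' + l (Suc i)}. G i x)"
  obtains x where "x \<in> {a..a + l 0}" "\<And>i. G i x"
proof (rule nested_interval_game[where l=l and a=a and G=G, OF assms])
  fix b assume b: "\<And>i. a \<le> b i" "\<And>i. b i + l i \<le> a + l 0"
    "\<And>i j x. i < j \<Longrightarrow> x \<in> {b j..b j + l j} \<Longrightarrow> G i x" "\<And>i j. i \<le> j \<Longrightarrow> b i \<le> b j \<and> b j + l j \<le> b i + l i"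
  have le: "b i \<le> b j + l j" for i j
  proof (cases "i \<le> j")
    case True then show ?thesis using b(4)[of i j] l[of j] by linarith
  next
    case False then show ?thesis using b(4)[of j i] l[of i] by linarith
  qed
  define x where "x = (SUP i. b i)"
  have bdd: "bdd_above (range b)" using le[of _ 0] by (intro bdd_aboveI[of _ "b 0 + l 0"]) auto
  have x: "x \<in> {b j..b j + l j}" for j
    unfolding x_def using le bdd by (auto intro!: cSUP_upper cSUP_least)
  show ?thesis
  proof (rule that[of x])
    show "x \<in> {a..a + l 0}" using x[of 0] b(1,2)[of 0] by auto
    show "G i x" for i using b(3)[of i "Suc i" x] x by blast
  qed
qed auto

subsection \<open>Limits of successive hits\<close>

definition avoids_from :: "real \<Rightarrow> real \<Rightarrow> real \<Rightarrow> nat \<Rightarrow> bool" where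
  "avoids_from \<alpha> c \<beta> Q \<longleftrightarrow> (\<forall>q\<ge>Q. c \<le> real q * \<parallel>real q * \<alpha> - \<beta>\<parallel>)"

text \<open>Outside the index \<open>q\<close> the new point keeps the bound \<open>c\<close> on the transitional range
  \<open>Q \<le> i < Q'\<close>, and from \<open>Q'\<close> on it satisfies the stronger bound \<open>c'\<close> needed to iterate.\<close>

definition extends_by_hit :: "real \<Rightarrow> real \<Rightarrow> real \<Rightarrow> real \<Rightarrow> real \<Rightarrow> nat \<Rightarrow> real \<Rightarrow> nat \<Rightarrow> nat \<Rightarrow> bool" where
  "extends_by_hit \<alpha> c' c \<eta> \<beta> Q \<beta>' q Q' \<longleftrightarrow>
     \<bar>\<beta>' - \<beta>\<bar> < \<eta> \<and> Q \<le> q \<and> q < Q' \<and> \<bar>real q * \<parallel>real q * \<alpha> - \<beta>'\<parallel> - c\<bar> < \<eta> \<and>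
     avoids_from \<alpha> c' \<beta>' Q' \<and>
     (\<forall>i\<in>{Q..<Q'} - {q}. c \<le> real i * \<parallel>real i * \<alpha> - \<beta>'\<parallel>)"

text \<open>The total later movement of the target is too small to disturb any index below the
  current threshold. Hence the hits converge to \<gamma> and bound the lower limit from above, while
  the windows from \<open>Q k\<close> to \<open>Q (Suc k)\<close> cover all late indices and bound
  it from below.\<close>

lemma M_plus_eq_if_extensions:
  fixes \<alpha> c' \<mu> \<gamma> :: real
  assumes \<mu>: "\<mu> > 0" and \<gamma>: "0 \<le> \<gamma>" "\<gamma> \<le> \<mu>" and start: "avoids_from \<alpha> c' \<beta>_init Q_init"
    and step: "\<And>c \<eta> \<beta> Q. 0 < c \<Longrightarrow> c \<le> \<mu> \<Longrightarrow> 0 < \<eta> \<Longrightarrow> avoids_from \<alpha> c' \<beta> Q \<Longrightarrow>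
      \<exists>\<beta>' q Q'. extends_by_hit \<alpha> c' c \<eta> \<beta> Q \<beta>' q Q'"
  shows "\<exists>\<beta>. M_plus \<alpha> \<beta> = ereal \<gamma>"
proof -
  \<comment> \<open>Extensions exist only for positive \<open>c\<close>, so \<open>\<gamma> = 0\<close> has to be approached from above.\<close>
  define c where "c k = max \<gamma> (\<mu> / real (Suc k))" for k
  have c: "0 < c k" "c k \<le> \<mu>" "\<gamma> \<le> c k" for k
    using \<mu> \<gamma> by (auto simp: c_def field_simps less_max_iff_disj)
  \<comment> \<open>The factor \<open>Suc Q\<close> in the denominator compensates the weight i < Q
    of an index that a later move may disturb.\<close>
  define \<eta> where "\<eta> k Q = (1/2) ^ k / real (Suc Q)" for k Q
  have \<eta>: "0 < \<eta> k Q" "\<eta> k Q \<le> (1/2)^k" "real Q * \<eta> k Q \<le> (1/2)^k" for k Q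
  proof -
    show "0 < \<eta> k Q" by (simp add: \<eta>_def del: of_nat_Suc)
    show "\<eta> k Q \<le> (1/2)^k"
      unfolding \<eta>_def by (subst pos_divide_le_eq) (auto simp: mult_le_cancel_left1)
    have "real Q / real (Suc Q) * (1/2)^k \<le> 1 * (1/2)^k" by (intro mult_right_mono) auto
    then show "real Q * \<eta> k Q \<le> (1/2)^k" by (simp add: \<eta>_def)
  qed
  \<comment> \<open>A state is a triple of target, hitting index and threshold. The hitting index
    belongs to the step that led to the state, which is why \<open>q n\<close> is read off from
    \<open>f (Suc n)\<close>.\<close>
  have "\<exists>f. \<forall>n. (avoids_from \<alpha> c' (fst (f n)) (snd (snd (f n)))) \<and>
     extends_by_hit \<alpha> c' (c n) (\<eta> n (snd (snd (f n)))) (fst (f n)) (snd (snd (f n))) (fst (f (Suc n))) (fst (snd (f (Suc n)))) (snd (snd (f (Suc n))))"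
  proof (rule dependent_nat_choice)
    show "\<exists>x. avoids_from \<alpha> c' (fst x) (snd (snd x))" using start by auto
  next
    fix x :: "real \<times> nat \<times> nat" and n
    assume "avoids_from \<alpha> c' (fst x) (snd (snd x))"
    from step[OF c(1,2)[of n] \<eta>(1)[of n "snd (snd x)"] this] obtain \<beta>' q Q'
      where "extends_by_hit \<alpha> c' (c n) (\<eta> n (snd (snd x))) (fst x) (snd (snd x)) \<beta>' q Q'" by blast
    moreover from this have "avoids_from \<alpha> c' \<beta>' Q'" by (simp add: extends_by_hit_def)
    ultimately show "\<exists>y. avoids_from \<alpha> c' (fst y) (snd (snd y)) \<and>
      extends_by_hit \<alpha> c' (c n) (\<eta> n (snd (snd x))) (fst x) (snd (snd x)) (fst y) (fst (snd y)) (snd (snd y))"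
      by (intro exI[of _ "(\<beta>', q, Q')"]) simp
  qed
  then obtain f where f: "\<And>n. extends_by_hit \<alpha> c' (c n) (\<eta> n (snd (snd (f n)))) (fst (f n)) (snd (snd (f n))) (fst (f (Suc n))) (fst (snd (f (Suc n)))) (snd (snd (f (Suc n))))"
    by blast
  define b where "b n = fst (f n)" for n
  define q where "q n = fst (snd (f (Suc n)))" for n
  define Q where "Q n = snd (snd (f n))" for n
  have ext: "extends_by_hit \<alpha> c' (c n) (\<eta> n (Q n)) (b n) (Q n) (b (Suc n)) (q n) (Q (Suc n))" for n
    using f[of n] by (simp add: b_def q_def Q_def)
  have Qq: "Q n \<le> q n" "q n < Q (Suc n)" for n using ext[of n] by (auto simp: extends_by_hit_def)
  have Q_mono: "strict_mono Q" using Qq by (intro strict_mono_Suc_iff[THEN iffD2]) (meson le_less_trans)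
  have q_mono: "strict_mono q" using Qq by (intro strict_mono_Suc_iff[THEN iffD2]) (meson less_le_trans)
  have db: "\<bar>b (Suc j) - b j\<bar> \<le> \<eta> k (Q k) * (1/2)^(j - k)" if "k \<le> j" for j k
  proof -
    have "\<bar>b (Suc j) - b j\<bar> \<le> \<eta> j (Q j)" using ext[of j] by (simp add: extends_by_hit_def)
    also have "\<dots> \<le> (1/2)^j / real (Suc (Q k))"
      unfolding \<eta>_def using Q_mono that by (intro divide_left_mono) (auto simp: strict_mono_less_eq)
    also have "\<dots> = \<eta> k (Q k) * (1/2)^(j - k)"
      unfolding \<eta>_def using that by (simp flip: power_add)
    finally show ?thesis .
  qed
  have dist_b: "\<bar>b (k + i) - b k\<bar> \<le> \<eta> k (Q k) * (2 - 2 * (1/2)^i)" for k i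
  proof (induction i)
    case (Suc i)
    have "\<bar>b (Suc (k + i)) - b (k + i)\<bar> \<le> \<eta> k (Q k) * (1/2)^i" using db[of k "k + i"] by simp
    then have "\<bar>b (k + Suc i) - b k\<bar> \<le> \<eta> k (Q k) * (2 - 2 * (1/2)^i) + \<eta> k (Q k) * (1/2)^i"
      using Suc by simp
    then show ?case by (simp add: algebra_simps)
  qed simp
  have dist_b2: "\<bar>b j - b k\<bar> \<le> 2 * \<eta> k (Q k)" if "k \<le> j" for j k
  proof -
    have "\<bar>b j - b k\<bar> \<le> \<eta> k (Q k) * (2 - 2 * (1/2)^(j - k))" using dist_b[of k "j - k"] that by simp
    also have "\<dots> \<le> \<eta> k (Q k) * 2" using \<eta>(1)[of k "Q k"] by (intro mult_left_mono) auto
    finally show ?thesis by simp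
  qed
  have half0: "(\<lambda>k. (1/2::real)^k) \<longlonglongrightarrow> 0" by (rule LIMSEQ_realpow_zero) auto
  have "Cauchy b"
  proof (rule metric_CauchyI)
    fix e :: real assume "e > 0"
    with half0 have "eventually (\<lambda>k. (1/2::real)^k < e/4) sequentially"
      by (intro order_tendstoD) auto
    then obtain k where k: "(1/2::real)^k < e/4" by (auto simp: eventually_sequentially)
    show "\<exists>M. \<forall>m\<ge>M. \<forall>n\<ge>M. dist (b m) (b n) < e"
    proof (intro exI[of _ k] allI impI)
      fix m n assume "k \<le> m" "k \<le> n"
      then show "dist (b m) (b n) < e" using dist_b2[of k m] dist_b2[of k n] \<eta>(2)[of k "Q k"] k
        unfolding dist_real_def by linarith
    qed
  qed
  then obtain \<beta> where \<beta>: "b \<longlonglongrightarrow> \<beta>" using Cauchy_convergent convergent_def by blast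
  have dist_\<beta>: "\<bar>\<beta> - b k\<bar> \<le> 2 * \<eta> k (Q k)" for k
  proof -
    have "(\<lambda>j. \<bar>b j - b k\<bar>) \<longlonglongrightarrow> \<bar>\<beta> - b k\<bar>" by (intro tendsto_intros \<beta>)
    then show ?thesis
      by (rule LIMSEQ_le_const2) (use dist_b2[of k] in auto)
  qed
  define e where "e k = 2 * (1/2::real)^k" for k
  have near: "\<bar>real i * \<parallel>real i * \<alpha> - \<beta>\<parallel> - real i * \<parallel>real i * \<alpha> - b (Suc k)\<parallel>\<bar> \<le> e k" if "i < Q (Suc k)" for i k
  proof -
    have "\<bar>\<parallel>real i * \<alpha> - \<beta>\<parallel> - \<parallel>real i * \<alpha> - b (Suc k)\<parallel>\<bar> \<le> \<bar>\<beta> - b (Suc k)\<bar>"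
      using dist_nearest_int_diff_ge[of "real i * \<alpha> - \<beta>" "real i * \<alpha> - b (Suc k)"]
        dist_nearest_int_diff_ge[of "real i * \<alpha> - b (Suc k)" "real i * \<alpha> - \<beta>"] by linarith
    also have "\<dots> \<le> 2 * \<eta> (Suc k) (Q (Suc k))" by (rule dist_\<beta>)
    finally have "real i * \<bar>\<parallel>real i * \<alpha> - \<beta>\<parallel> - \<parallel>real i * \<alpha> - b (Suc k)\<parallel>\<bar> \<le> real (Q (Suc k)) * (2 * \<eta> (Suc k) (Q (Suc k)))"
      using that by (intro mult_mono) auto
    also have "\<dots> = 2 * (real (Q (Suc k)) * \<eta> (Suc k) (Q (Suc k)))" by simp
    also have "\<dots> \<le> 2 * (1/2)^(Suc k)" using \<eta>(3)[of "Q (Suc k)" "Suc k"] by linarith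
    also have "\<dots> \<le> e k" by (simp add: e_def)
    finally have "\<bar>real i * (\<parallel>real i * \<alpha> - \<beta>\<parallel> - \<parallel>real i * \<alpha> - b (Suc k)\<parallel>)\<bar> \<le> e k" by (simp add: abs_mult)
    then show ?thesis by (simp add: right_diff_distrib)
  qed
  define X where "X i = real i * \<parallel>real i * \<alpha> - \<beta>\<parallel>" for i
  have hit: "\<bar>X (q k) - c k\<bar> \<le> 2 * e k" for k
  proof -
    have "\<bar>real (q k) * \<parallel>real (q k) * \<alpha> - b (Suc k)\<parallel> - c k\<bar> < \<eta> k (Q k)"
      using ext[of k] by (simp add: extends_by_hit_def)
    moreover have "\<eta> k (Q k) \<le> e k" using \<eta>(2)[of k "Q k"] zero_le_power[of "1/2::real" k]
      unfolding e_def by linarith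
    ultimately show ?thesis using near[of "q k" k] Qq[of k] unfolding X_def by linarith
  qed
  have e_lim: "e \<longlonglongrightarrow> 0" unfolding e_def using tendsto_mult_left[OF half0, of 2] by simp
  have e_anti: "e j \<le> e k" if "k \<le> j" for j k
    unfolding e_def using that by (simp add: power_decreasing)
  have c_lim: "c \<longlonglongrightarrow> \<gamma>"
  proof -
    have "(\<lambda>k. \<mu> / real (Suc k)) \<longlonglongrightarrow> 0" by (rule LIMSEQ_Suc[OF lim_const_over_n])
    then have "c \<longlonglongrightarrow> max \<gamma> 0" unfolding c_def by (intro tendsto_max tendsto_const)
    then show ?thesis using \<gamma> by simp
  qed
  have Xq: "(\<lambda>k. X (q k)) \<longlonglongrightarrow> \<gamma>"
  proof -
    have "(\<lambda>k. X (q k) - c k) \<longlonglongrightarrow> 0"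
      by (rule Lim_null_comparison[where g="\<lambda>k. 2 * e k"]) (use hit tendsto_mult_left[OF e_lim, of 2] in auto)
    from tendsto_add[OF this c_lim] show ?thesis by simp
  qed
  have low: "\<gamma> - 2 * e k \<le> X i" if i: "Q k \<le> i" for i k
  proof -
    \<comment> \<open>The window of i: \<open>Q j\<close> \<le> i < \<open>Q (Suc j)\<close>.
      Minimality of j gives the left inequality, except at j = k, where it is the
      assumption.\<close>
    define j where "j = (LEAST j. i < Q (Suc j))"
    have "i < Q (Suc i)" using strict_mono_imp_increasing[OF Q_mono, of "Suc i"] by simp
    then have j: "i < Q (Suc j)" unfolding j_def by (rule LeastI)
    have "Q k < Q (Suc j)" using i j by simp
    then have kj: "k \<le> j" using strict_mono_less[OF Q_mono, of k "Suc j"] by simp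
    have Qj: "Q j \<le> i"
    proof (cases "j = k")
      case False
      then obtain j' where j': "j = Suc j'" using kj by (cases j) auto
      show ?thesis using not_less_Least[of j' "\<lambda>j. i < Q (Suc j)"] j' unfolding j_def by simp
    qed (use i in simp)
    have ej: "2 * e j \<le> 2 * e k" "e j \<ge> 0" using e_anti[OF kj] by (auto simp: e_def)
    show ?thesis
    proof (cases "i = q j")
      case True
      then show ?thesis using hit[of j] c(3)[of j] ej by auto
    next
      case False
      then have "c j \<le> real i * \<parallel>real i * \<alpha> - b (Suc j)\<parallel>"
        using ext[of j] j Qj by (auto simp: extends_by_hit_def)
      then show ?thesis using near[OF j] c(3)[of j] ej unfolding X_def by linarith
    qed
  qed
  have "liminf (\<lambda>i. ereal (X i)) \<le> liminf ((\<lambda>i. ereal (X i)) \<circ> q)"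
    by (rule liminf_subseq_mono[OF q_mono])
  also have "\<dots> = ereal \<gamma>"
    by (rule lim_imp_Liminf) (use Xq in \<open>auto simp: o_def\<close>)
  finally have "liminf (\<lambda>i. ereal (X i)) \<le> ereal \<gamma>" .
  moreover have "ereal \<gamma> \<le> liminf (\<lambda>i. ereal (X i))"
  proof (rule LIMSEQ_le_const2)
    show "(\<lambda>k. ereal (\<gamma> - 2 * e k)) \<longlonglongrightarrow> ereal \<gamma>"
      using tendsto_diff[OF tendsto_const[of \<gamma>] tendsto_mult_left[OF e_lim, of 2]] by simp
    have "ereal (\<gamma> - 2 * e k) \<le> liminf (\<lambda>i. ereal (X i))" for k
      by (rule Liminf_bounded) (use low in \<open>auto simp: eventually_sequentially\<close>)
    then show "\<exists>N. \<forall>n\<ge>N. ereal (\<gamma> - 2 * e n) \<le> liminf (\<lambda>i. ereal (X i))" by auto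
  qed
  ultimately have "M_plus \<alpha> \<beta> = ereal \<gamma>" unfolding M_plus_def X_def by (rule antisym)
  then show ?thesis by blast
qed

section \<open>Periodicity in \<beta> and the passage to \<open>S_plus\<close>\<close>

lemma M_plus_add_of_int: "M_plus \<alpha> (\<beta> + of_int k) = M_plus \<alpha> \<beta>"
proof -
  have "\<parallel>x - (\<beta> + of_int k)\<parallel> = \<parallel>x - \<beta>\<parallel>" for x
    by (rule dist_nearest_int_cong[of _ _ "- k"]) simp
  then show ?thesis by (simp add: M_plus_def)
qed

lemma S_plus_eq_range: "S_plus \<alpha> = range (M_plus \<alpha>)"
proof -
  have "M_plus \<alpha> \<beta> \<in> S_plus \<alpha>" for \<beta>
  proof -
    obtain k :: nat where "- \<beta> < real k" using reals_Archimedean2 by blast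
    then show ?thesis unfolding S_plus_def
      by (intro CollectI exI[of _ "\<beta> + of_int (int k)"]) (simp only: M_plus_add_of_int, simp)
  qed
  then show ?thesis by (auto simp: S_plus_def)
qed

lemma interval_subset_S_plus_if_extensions:
  fixes \<alpha> c' \<mu> :: real
  assumes "\<mu> > 0" "avoids_from \<alpha> c' \<beta>_init Q_init"
    and "\<And>c \<eta> \<beta> Q. 0 < c \<Longrightarrow> c \<le> \<mu> \<Longrightarrow> 0 < \<eta> \<Longrightarrow> avoids_from \<alpha> c' \<beta> Q \<Longrightarrow>
      \<exists>\<beta>' q Q'. extends_by_hit \<alpha> c' c \<eta> \<beta> Q \<beta>' q Q'"
  shows "{0..ereal \<mu>} \<subseteq> S_plus \<alpha>"
proof
  fix x assume "x \<in> {0..ereal \<mu>}"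
  then obtain \<gamma> where "x = ereal \<gamma>" "0 \<le> \<gamma>" "\<gamma> \<le> \<mu>" by (cases x) auto
  moreover have "\<exists>\<beta>. M_plus \<alpha> \<beta> = ereal \<gamma>"
    by (rule M_plus_eq_if_extensions[where \<mu>=\<mu> and c'=c' and \<beta>_init=\<beta>_init and Q_init=Q_init])
      (use assms calculation in auto)
  ultimately show "x \<in> S_plus \<alpha>" unfolding S_plus_eq_range by (metis rangeI)
qed

subsection \<open>Badly approximable numbers\<close>

locale badly_approximable =
  fixes \<alpha> \<kappa> :: real
  assumes kappa_pos: "\<kappa> > 0"
    and kappa: "\<And>t::int. t \<noteq> 0 \<Longrightarrow> \<kappa> \<le> \<bar>of_int t\<bar> * \<parallel>of_int t * \<alpha>\<parallel>"
begin

lemma kappa_le_half: "\<kappa> \<le> 1/2"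
  using kappa[of 1] of_int_round_abs_le[of \<alpha>] by (simp add: dist_nearest_int_def abs_minus_commute)

text \<open>The separation principle behind the diameter bounds of this part: two distinct indices
  at most A apart contradict bad approximability as soon as A B < \<kappa>.\<close>

lemma kappa_mult:
  assumes "t \<noteq> u" "\<bar>of_int (t - u)\<bar> \<le> A" "\<parallel>of_int (t - u) * \<alpha>\<parallel> \<le> B"
  shows "\<kappa> \<le> A * B"
proof -
  have "\<kappa> \<le> \<bar>of_int (t - u)\<bar> * \<parallel>of_int (t - u) * \<alpha>\<parallel>" by (rule kappa) (use assms(1) in simp)
  also have "\<dots> \<le> A * B" using assms(2,3) by (intro mult_mono) auto
  finally show ?thesis .
qed

text \<open>Stage i treats Y \<le> t < 7Y with Y = 7^i N, where the bad neighbourhoods have radius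
  at most d = c/Y. Inside an interval of length 14d only one t can contribute: for two, the
  difference would satisfy \<parallel>(t - u)\<alpha>\<parallel> \<le> 2d + 14d, whence \<kappa>
  \<le> 7Y * 16d = 112c. So the bad set has diameter at most 2d, a seventh of the interval.\<close>

lemma avoiding_point_in_interval:
  fixes a c N :: real
  assumes "0 < c" "200 * c \<le> \<kappa>" "1 \<le> N"
  obtains x where "a \<le> x" "x \<le> a + 14 * c / N" "\<And>t::int. N \<le> of_int t \<Longrightarrow> c \<le> of_int t * \<parallel>of_int t * \<alpha> - x\<parallel>"
proof -
  define l where "l i = 14 * c / (7 ^ i * N)" for i
  define G where "G i x \<longleftrightarrow> (\<forall>t::int. 7 ^ i * N \<le> of_int t \<longrightarrow> of_int t < 7 ^ Suc i * N \<longrightarrow>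
      c \<le> of_int t * \<parallel>of_int t * \<alpha> - x\<parallel>)" for i :: nat and x
  have l: "l i \<ge> 0" for i using assms by (simp add: l_def)
  obtain x where x: "x \<in> {a..a + l 0}" "\<And>i. G i x"
  proof (rule nested_interval_game_limit[where l=l and G=G and a=a, OF l])
    fix i b
    define Y where "Y = 7 ^ i * N"
    have "1 * 1 \<le> 7 ^ i * N" using assms(3) by (intro mult_mono) auto
    then have Y: "Y \<ge> 1" by (simp add: Y_def)
    define d where "d = c / Y"
    have d: "0 < d" "d \<le> c" "d * Y = c" using Y assms by (auto simp: d_def field_simps)
    have li: "l i = 14 * d" "l (Suc i) = 2 * d" by (simp_all add: l_def d_def Y_def)
    define W where "W = {x. \<not> G i x}"
    have diam: "\<bar>x - y\<bar> \<le> 2 * d" if xy: "x \<in> W" "y \<in> W" "x \<in> {b..b + real 7 * (2 * d)}" "y \<in> {b..b + real 7 * (2 * d)}" for x y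
    proof -
      from xy(1) obtain t :: int where t: "Y \<le> of_int t" "of_int t < 7 * Y" "of_int t * \<parallel>of_int t * \<alpha> - x\<parallel> < c"
        unfolding W_def G_def Y_def by (auto simp: not_le)
      from xy(2) obtain u :: int where u: "Y \<le> of_int u" "of_int u < 7 * Y" "of_int u * \<parallel>of_int u * \<alpha> - y\<parallel> < c"
        unfolding W_def G_def Y_def by (auto simp: not_le)
      have small: "\<parallel>of_int s * \<alpha> - z\<parallel> \<le> d" if "Y \<le> of_int s" "of_int s * \<parallel>of_int s * \<alpha> - z\<parallel> < c" for s :: int and z
      proof -
        have "Y * \<parallel>of_int s * \<alpha> - z\<parallel> \<le> of_int s * \<parallel>of_int s * \<alpha> - z\<parallel>" using that by (intro mult_right_mono) auto
        then have "Y * \<parallel>of_int s * \<alpha> - z\<parallel> \<le> c" using that by linarith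
        then show ?thesis unfolding d_def using Y by (simp add: field_simps)
      qed
      have tu: "\<parallel>of_int t * \<alpha> - x\<parallel> \<le> d" "\<parallel>of_int u * \<alpha> - y\<parallel> \<le> d" using small t u by auto
      have xy14: "\<bar>x - y\<bar> \<le> 14 * d" using xy(3,4) by auto
      have tri: "\<parallel>of_int (t - u) * \<alpha> - (x - y)\<parallel> \<le> 2 * d"
        using dist_nearest_int_triangle_diff[of "of_int t * \<alpha> - x" "of_int u * \<alpha> - y"] tu
        by (simp add: algebra_simps)
      show ?thesis
      proof (cases "t = u")
        case True
        then have "\<parallel>x - y\<parallel> \<le> 2 * d" using tri dist_nearest_int_minus[of "x - y"] by simp
        moreover have "\<bar>x - y\<bar> \<le> 1/2" using xy14 d assms(2) kappa_le_half by linarith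
        ultimately show ?thesis using dist_nearest_int_eq_abs by simp
      next
        case False
        have "\<parallel>of_int (t - u) * \<alpha>\<parallel> \<le> 16 * d"
          using dist_nearest_int_diff_ge[of "of_int (t - u) * \<alpha>" "of_int (t - u) * \<alpha> - (x - y)"] tri xy14 by simp
        moreover have "\<bar>of_int (t - u)\<bar> \<le> 7 * Y" using t u by auto
        ultimately have "\<kappa> \<le> 7 * Y * (16 * d)" using False by (intro kappa_mult) auto
        also have "\<dots> = 112 * c" using d(3) by (simp add: algebra_simps)
        finally show ?thesis using assms(1,2) by linarith
      qed
    qed
    obtain b' where "b \<le> b'" "b' + 2 * d \<le> b + real 7 * (2 * d)" "\<And>x. x \<in> {b'..b' + 2 * d} \<Longrightarrow> x \<notin> W"
      by (rule subinterval_avoiding_finite[where l="2*d" and F="{W}" and R=7 and a=b])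
        (use d diam in auto)
    then show "\<exists>b'\<ge>b. b' + l (Suc i) \<le> b + l i \<and> (\<forall>x\<in>{b'..b' + l (Suc i)}. G i x)"
      unfolding li W_def by (intro exI[of _ b']) auto
  qed blast
  show ?thesis
  proof (rule that[of x])
    show "a \<le> x" "x \<le> a + 14 * c / N" using x(1) by (auto simp: l_def)
    fix t :: int assume t: "N \<le> of_int t"
    then have "1 \<le> of_int t / N" using assms(3) by simp
    then obtain i where "7 ^ i \<le> of_int t / N" "of_int t / N < 7 ^ Suc i"
      by (rule power_bracket[of _ 7]) auto
    then show "c \<le> of_int t * \<parallel>of_int t * \<alpha> - x\<parallel>"
      using x(2)[of i] assms(3) unfolding G_def by (simp add: field_simps)
  qed
qed

text \<open>Here \<open>s\<close> is the real parameter that will become the hitting time \<open>q\<close>, with \<open>y = c / s\<close>.  The first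
  property concerns the orbit points before the hit: in terms of \<open>i = q - n\<close> it says \<open>i \<parallel>(q - i)\<alpha>\<parallel> > \<kappa> / 1000\<close>.
  The second one concerns the points after the hit.\<close>

lemma hit_scale_interval:
  fixes c e S :: real and m :: nat
  assumes c: "0 < c" "c \<le> 1/2" and e: "0 < e" "1000 * e \<le> \<kappa>" and S: "1 \<le> S"
  obtains b where "S \<le> b" "b + S / 7 ^ m \<le> 2 * S"
    "\<And>s n. s \<in> {b..b + S / 7 ^ m} \<Longrightarrow> 1 \<le> n \<Longrightarrow> of_int n \<le> s \<Longrightarrow>
        S * \<parallel>of_int n * \<alpha>\<parallel> \<le> \<kappa> / 1000 * 7 ^ m \<Longrightarrow> \<kappa> / 1000 < (s - of_int n) * \<parallel>of_int n * \<alpha>\<parallel>"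
    "\<And>s n. s \<in> {b..b + S / 7 ^ m} \<Longrightarrow> 1 \<le> n \<Longrightarrow> of_int n < 8 * e / c * 7 ^ Suc m * S \<Longrightarrow>
        e \<le> of_int n * \<parallel>of_int n * \<alpha> - c / s\<parallel>"
proof -
  define f where "f = \<kappa> / 1000"
  have f: "0 < f" "1000 * f = \<kappa>" using kappa_pos by (auto simp: f_def)
  define l where "l i = S / 7 ^ i" for i
  \<comment> \<open>A bad n of the window 7^i confines s to a stretch of length S/(7 * 7^i) to the
    right of n, one seventh of the current interval. Two different n are excluded by
    \<open>kappa_mult\<close>, which would give \<kappa> \<le> 196f.\<close>
  define past where "past i s n \<longleftrightarrow> 1 \<le> n \<and> of_int n \<le> s \<and> 7 * f * 7 ^ i \<le> S * \<parallel>of_int n * \<alpha>\<parallel> \<and>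
     S * \<parallel>of_int n * \<alpha>\<parallel> \<le> 49 * f * 7 ^ i \<and> (s - of_int n) * \<parallel>of_int n * \<alpha>\<parallel> \<le> f" for i :: nat and s n
  \<comment> \<open>The factor 56 is 7 * 8: on [S, 2S], closeness of c/s and c/s' up to 2h only
    yields |s - s'| \<le> 8hS^2/c, and the result must be a seventh of the current length.\<close>
  define future where "future i s n \<longleftrightarrow> 1 \<le> n \<and> 56 * e * 7 ^ i * S \<le> c * of_int n \<and> c * of_int n < 7 * (56 * e * 7 ^ i * S)
     \<and> of_int n * \<parallel>of_int n * \<alpha> - c / s\<parallel> < e" for i :: nat and s n
  have past_diam: "\<bar>s - s'\<bar> \<le> S / (7 * 7 ^ i)" if p: "past i s n" "past i s' n'" and ss: "\<bar>s - s'\<bar> \<le> S / 7 ^ i" for i s s' n n'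
  proof -
    define z :: real where "z = 7 ^ i"
    have z: "z \<ge> 1" by (simp add: z_def)
    define w w' where "w = \<parallel>of_int n * \<alpha>\<parallel>" and "w' = \<parallel>of_int n' * \<alpha>\<parallel>"
    have gap: "t - of_int k \<le> S / (7 * z)" if "past i t k" for t k
    proof -
      have *: "7 * f * z \<le> S * \<parallel>of_int k * \<alpha>\<parallel>" "(t - of_int k) * \<parallel>of_int k * \<alpha>\<parallel> \<le> f" "of_int k \<le> t"
        using that by (auto simp: past_def z_def)
      have "(t - of_int k) * (7 * f * z) \<le> (t - of_int k) * (S * \<parallel>of_int k * \<alpha>\<parallel>)"
        using * by (intro mult_left_mono) auto
      also have "\<dots> = S * ((t - of_int k) * \<parallel>of_int k * \<alpha>\<parallel>)" by simp
      also have "\<dots> \<le> S * f" using *(2) S by (intro mult_left_mono) auto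
      finally have "f * ((t - of_int k) * (7 * z)) \<le> f * S" by (simp add: algebra_simps)
      then have "(t - of_int k) * (7 * z) \<le> S" using f by simp
      then show ?thesis using z by (simp add: field_simps)
    qed
    have g: "of_int n \<le> s" "s - of_int n \<le> S / (7 * z)" "of_int n' \<le> s'" "s' - of_int n' \<le> S / (7 * z)"
      using p gap by (auto simp: past_def)
    show ?thesis
    proof (cases "n = n'")
      case True
      then show ?thesis using g unfolding z_def by (simp add: abs_le_iff)
    next
      case False
      have "S / (7 * z) \<le> S / z" using S z by (intro divide_left_mono) auto
      then have A: "\<bar>of_int (n - n')\<bar> \<le> 2 * (S / z)" using g ss unfolding z_def[symmetric] by (simp add: abs_le_iff)
      have "S * w \<le> 49 * f * z" "S * w' \<le> 49 * f * z" using p by (auto simp: past_def w_def w'_def z_def)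
      then have "S * (w + w') \<le> 98 * f * z" by (simp add: algebra_simps)
      moreover have "\<parallel>of_int (n - n') * \<alpha>\<parallel> \<le> w + w'"
        using dist_nearest_int_triangle_diff[of "of_int n * \<alpha>" "of_int n' * \<alpha>"] by (simp add: w_def w'_def algebra_simps)
      then have "S * \<parallel>of_int (n - n') * \<alpha>\<parallel> \<le> S * (w + w')" using S by (intro mult_left_mono) auto
      ultimately have "S * \<parallel>of_int (n - n') * \<alpha>\<parallel> \<le> 98 * f * z" by linarith
      then have "\<parallel>of_int (n - n') * \<alpha>\<parallel> \<le> 98 * f * z / S" using S by (simp add: field_simps)
      from kappa_mult[OF False A this] have "\<kappa> \<le> 196 * f" using S z by (simp add: field_simps)
      then show ?thesis using f by linarith
    qed
  qed
  have future_diam: "\<bar>s - s'\<bar> \<le> S / (7 * 7 ^ i)"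
    if p: "future i s n" "future i s' n'" and ss: "\<bar>s - s'\<bar> \<le> S / 7 ^ i" and S2: "s \<in> {S..2*S}" "s' \<in> {S..2*S}" for i s s' n n'
  proof -
    define z :: real where "z = 7 ^ i"
    have z: "z \<ge> 1" by (simp add: z_def)
    define h where "h = c / (56 * z * S)"
    have h: "h > 0" "56 * e * z * S * h = e * c" using c S z by (auto simp: h_def)
    have pos: "s > 0" "s' > 0" using S S2 by auto
    have small: "\<parallel>of_int k * \<alpha> - c / t\<parallel> \<le> h" if "future i t k" for t k
    proof -
      have *: "56 * e * z * S \<le> c * of_int k" "of_int k * \<parallel>of_int k * \<alpha> - c / t\<parallel> < e"
        using that by (auto simp: future_def z_def)
      have "56 * e * z * S * \<parallel>of_int k * \<alpha> - c / t\<parallel> \<le> c * of_int k * \<parallel>of_int k * \<alpha> - c / t\<parallel>"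
        using * by (intro mult_right_mono) auto
      also have "\<dots> \<le> c * e" using * c by simp
      also have "\<dots> = 56 * e * z * S * h" unfolding h(2) by simp
      finally have "56 * e * z * S * \<parallel>of_int k * \<alpha> - c / t\<parallel> \<le> 56 * e * z * S * h" .
      then show ?thesis using e S z by simp
    qed
    have tri: "\<parallel>of_int (n - n') * \<alpha> - (c / s - c / s')\<parallel> \<le> 2 * h"
      using dist_nearest_int_triangle_diff[of "of_int n * \<alpha> - c / s" "of_int n' * \<alpha> - c / s'"] small[OF p(1)] small[OF p(2)]
      by (simp add: algebra_simps)
    have diff: "\<bar>c / s - c / s'\<bar> * (s * s') = c * \<bar>s - s'\<bar>"
    proof -
      have "(c / s - c / s') * (s * s') = c * (s' - s)" using pos by (simp add: field_simps)
      then have "\<bar>(c / s - c / s') * (s * s')\<bar> = \<bar>c * (s' - s)\<bar>" by simp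
      then show ?thesis using pos c by (simp add: abs_mult abs_minus_commute)
    qed
    have SS: "S * S \<le> s * s'" "s * s' \<le> (2 * S) * (2 * S)"
      using S S2 mult_mono[of S s S s'] mult_mono[of s "2 * S" s' "2 * S"] by auto
    show ?thesis
    proof (cases "n = n'")
      case True
      then have 1: "\<parallel>c / s - c / s'\<parallel> \<le> 2 * h" using tri dist_nearest_int_minus[of "c / s - c / s'"] by simp
      have "0 \<le> c / s" "c / s \<le> c" "0 \<le> c / s'" "c / s' \<le> c" using c S S2 pos by (auto simp: field_simps)
      then have "\<bar>c / s - c / s'\<bar> \<le> 1/2" using c by linarith
      then have "\<bar>c / s - c / s'\<bar> \<le> 2 * h" using 1 dist_nearest_int_eq_abs by simp
      then have "\<bar>c / s - c / s'\<bar> * (s * s') \<le> 2 * h * ((2 * S) * (2 * S))" 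
        by (rule mult_mono) (use SS pos h in auto)
      then have "c * \<bar>s - s'\<bar> \<le> 8 * h * S * S" unfolding diff by simp
      also have "\<dots> = c * (S / (7 * z))" using S z by (simp add: h_def field_simps)
      finally show ?thesis using c(1) unfolding z_def by (rule mult_left_le_imp_le)
    next
      case False
      \<comment> \<open>Over the current interval c/s varies by at most 56h. Together with the two
        errors h this gives \<parallel>(n - n')\<alpha>\<parallel> \<le> 58h, too small for two
        distinct n of one window.\<close>
      have "\<bar>c / s - c / s'\<bar> * (S * S) \<le> c * \<bar>s - s'\<bar>" unfolding diff[symmetric] using SS by (intro mult_left_mono) auto
      also have "\<dots> \<le> c * (S / z)" by (rule mult_left_mono) (use ss c in \<open>auto simp: z_def\<close>)
      also have "\<dots> = 56 * h * (S * S)" using S z by (simp add: h_def field_simps)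
      finally have "\<bar>c / s - c / s'\<bar> \<le> 56 * h" using S by simp
      then have B: "\<parallel>of_int (n - n') * \<alpha>\<parallel> \<le> 58 * h"
        using dist_nearest_int_diff_ge[of "of_int (n - n') * \<alpha>" "of_int (n - n') * \<alpha> - (c / s - c / s')"] tri by simp
      have "1 \<le> n" "1 \<le> n'" "c * of_int n \<le> 392 * e * z * S" "c * of_int n' \<le> 392 * e * z * S"
        using p by (auto simp: future_def z_def)
      then have "of_int n \<le> 392 * e * z * S / c" "of_int n' \<le> 392 * e * z * S / c" "0 \<le> real_of_int n" "0 \<le> real_of_int n'"
        using c by (auto simp: field_simps)
      then have A: "\<bar>of_int (n - n')\<bar> \<le> 392 * e * z * S / c" by (simp add: abs_le_iff)
      have "\<kappa> \<le> 392 * e * z * S / c * (58 * h)" by (rule kappa_mult[OF False A B])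
      also have "\<dots> = 406 * e" using c S z by (simp add: h_def field_simps)
      finally show ?thesis using e by linarith
    qed
  qed
  define G where "G i s \<longleftrightarrow> (\<forall>n. \<not> past i s n \<and> \<not> future i s n)" for i s
  have l: "l i \<ge> 0" for i using S by (simp add: l_def)
  obtain b where b: "\<And>i. S \<le> b i" "\<And>i. b i + l i \<le> S + l 0" "\<And>i j x. i < j \<Longrightarrow> x \<in> {b j..b j + l j} \<Longrightarrow> G i x"
  proof (rule nested_interval_game[where l=l and G=G and a=S, OF l])
    fix i a assume a: "S \<le> a" "a + l i \<le> S + l 0"
    define d where "d = l (Suc i)"
    have li: "l i = 7 * d" "d = S / (7 * 7 ^ i)" "d > 0" using S by (auto simp: l_def d_def)
    define P F where "P = {s. \<exists>n. past i s n}" and "F = {s. \<exists>n. future i s n}"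
    have "{a..a + real 7 * d} \<subseteq> {S..2 * S}" using a li by (auto simp: l_def)
    moreover have "7 * d = S / 7 ^ i" using li by (simp add: l_def)
    ultimately have diam: "\<bar>x - y\<bar> \<le> d" if "W \<in> {P, F}" "x \<in> W" "y \<in> W" "x \<in> {a..a + real 7 * d}" "y \<in> {a..a + real 7 * d}" for W x y
    proof -
      have "x \<in> {S..2*S}" "y \<in> {S..2*S}" using that(4,5) \<open>{a..a + real 7 * d} \<subseteq> {S..2 * S}\<close> by blast+
      moreover have "\<bar>x - y\<bar> \<le> S / 7 ^ i" using that(4,5) \<open>7 * d = S / 7 ^ i\<close> by (simp add: abs_le_iff)
      ultimately show ?thesis
        using that(1-3) past_diam[of i x _ y] future_diam[of i x _ y] unfolding li(2) P_def F_def by blast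
    qed
    \<comment> \<open>Two bad sets per stage account for the ratio 7 = 3 * 2 + 1 of successive
      lengths.\<close>
    have "card {P, F} \<le> 2" by (simp add: card_insert_if)
    then have card: "3 * card {P, F} + 1 \<le> 7" by simp
    obtain a' where "a \<le> a'" "a' + d \<le> a + real 7 * d" "\<And>W x. W \<in> {P, F} \<Longrightarrow> x \<in> {a'..a' + d} \<Longrightarrow> x \<notin> W"
    proof (rule subinterval_avoiding_finite[OF li(3) _ card, of a])
      show "\<bar>x - y\<bar> \<le> d" if "W \<in> {P, F}" "x \<in> W" "y \<in> W" "x \<in> {a..a + real 7 * d}" "y \<in> {a..a + real 7 * d}" for W x y
        using diam[OF that] .
    qed (simp, rule that)
    moreover from this(3) have "G i x" if "x \<in> {a'..a' + d}" for x
      using that unfolding G_def P_def F_def by blast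
    ultimately show "\<exists>a'\<ge>a. a' + l (Suc i) \<le> a + l i \<and> (\<forall>x\<in>{a'..a' + l (Suc i)}. G i x)"
      unfolding li(1) d_def[symmetric] by (intro exI[of _ a']) simp
  qed blast
  show ?thesis
  proof (rule that[of "b m"])
    show "S \<le> b m" "b m + S / 7 ^ m \<le> 2 * S" using b(1,2)[of m] by (auto simp: l_def)
    fix s :: real and n :: int assume s: "s \<in> {b m..b m + S / 7 ^ m}" and n: "1 \<le> n"
    have sS: "S \<le> s" "s \<le> 2 * S" using s b(1,2)[of m] by (auto simp: l_def)
    have G: "G i s" if "i < m" for i using b(3)[OF that] s by (simp add: l_def)
    have kn: "\<kappa> \<le> of_int n * \<parallel>of_int n * \<alpha>\<parallel>" using kappa[of n] n by simp
    show "\<kappa> / 1000 < (s - of_int n) * \<parallel>of_int n * \<alpha>\<parallel>"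
      if ns: "of_int n \<le> s" and w: "S * \<parallel>of_int n * \<alpha>\<parallel> \<le> \<kappa> / 1000 * 7 ^ m"
    proof (rule ccontr)
      assume "\<not> ?thesis"
      then have near: "(s - of_int n) * \<parallel>of_int n * \<alpha>\<parallel> \<le> f" by (simp add: f_def)
      \<comment> \<open>Bad approximability and n \<le> 2S put S\<parallel>n\<alpha>\<parallel>
        above the start 7f of the lowest window, so n falls into a window; the assumed upper bound
        makes its number smaller than m.\<close>
      have "of_int n * \<parallel>of_int n * \<alpha>\<parallel> \<le> 2 * S * \<parallel>of_int n * \<alpha>\<parallel>" using ns sS by (intro mult_right_mono) auto
      then have "1 \<le> S * \<parallel>of_int n * \<alpha>\<parallel> / (7 * f)" using kn f by (simp add: field_simps)
      then obtain i where i: "7 ^ i \<le> S * \<parallel>of_int n * \<alpha>\<parallel> / (7 * f)" "S * \<parallel>of_int n * \<alpha>\<parallel> / (7 * f) < 7 ^ Suc i"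
        by (rule power_bracket[of _ 7]) auto
      have "f * 7 ^ Suc i \<le> S * \<parallel>of_int n * \<alpha>\<parallel>" using i(1) f by (simp add: field_simps)
      also have "\<dots> \<le> f * 7 ^ m" using w by (simp add: f_def)
      finally have "7 ^ Suc i \<le> (7::real) ^ m" using f(1) by (rule mult_left_le_imp_le)
      then have "i < m" using power_le_imp_le_exp[of "7::real" "Suc i" m] by simp
      from G[OF this] have "\<not> past i s n" by (simp add: G_def)
      moreover have "past i s n" unfolding past_def using i n ns near f by (simp add: field_simps)
      ultimately show False by simp
    qed
    show "e \<le> of_int n * \<parallel>of_int n * \<alpha> - c / s\<parallel>" if "of_int n < 8 * e / c * 7 ^ Suc m * S"
    proof (rule ccontr)
      assume "\<not> ?thesis"
      then have near: "of_int n * \<parallel>of_int n * \<alpha> - c / s\<parallel> < e" by simp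
      have nm: "c * of_int n < 56 * e * S * 7 ^ m" using that c by (simp add: field_simps)
      show False
      proof (cases "c * of_int n < 56 * e * S")
        case True
        \<comment> \<open>Before the first window nc/s is at most 56e, so a bad n would satisfy
          n\<parallel>n\<alpha>\<parallel> < 57e < \<kappa>.\<close>
        have "of_int n * \<parallel>of_int n * \<alpha>\<parallel> \<le> of_int n * (\<parallel>of_int n * \<alpha> - c / s\<parallel> + c / s)"
          using dist_nearest_int_diff_ge[of "of_int n * \<alpha>" "of_int n * \<alpha> - c / s"] n c sS S by (intro mult_left_mono) auto
        also have "\<dots> = of_int n * \<parallel>of_int n * \<alpha> - c / s\<parallel> + c * of_int n / s" by (simp add: algebra_simps)
        also have "c * of_int n / s \<le> 56 * e"
        proof -
          have "c * of_int n \<le> 56 * e * s" using True sS e by (smt (verit) mult_left_mono)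
          then show ?thesis using sS S by (simp add: field_simps)
        qed
        finally show False using kn near e by linarith
      next
        case False
        then have "1 \<le> c * of_int n / (56 * e * S)" using e S by (simp add: field_simps)
        then obtain i where i: "7 ^ i \<le> c * of_int n / (56 * e * S)" "c * of_int n / (56 * e * S) < 7 ^ Suc i"
          by (rule power_bracket[of _ 7]) auto
        have "56 * e * S * 7 ^ i \<le> c * of_int n" using i(1) e S by (simp add: field_simps)
        also note nm
        finally have "56 * e * S * 7 ^ i < 56 * e * S * 7 ^ m" .
        then have "(7::real) ^ i < 7 ^ m" by (rule mult_left_less_imp_less) (use e S in simp)
        then have "i < m" by simp
        from G[OF this] have "\<not> future i s n" by (simp add: G_def)
        moreover have "future i s n" unfolding future_def using i n near e S by (simp add: field_simps)
        ultimately show False by simp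
      qed
    qed
  qed
qed

text \<open>Bad approximability forces the Dirichlet denominator n \<le> L/2 to be at least
  \<kappa>L/4. A block of n integers therefore fits into the interval and approximates every x with
  error of order 1/(\<kappa>L).\<close>

lemma inhomogeneous_approx_in_interval:
  fixes a L x :: real
  assumes "4 \<le> L"
  obtains q k :: int where "a \<le> of_int q" "of_int q \<le> a + L" "\<bar>of_int q * \<alpha> - of_int k - x\<bar> \<le> 6 / (\<kappa> * L)"
proof -
  obtain n p where np: "coprime n p" "0 < n" "of_int n \<le> L / 2" "\<bar>of_int n * \<alpha> - of_int p\<bar> < 2 / (L / 2)"
    by (rule dirichlet_coprime_int[of "L / 2" \<alpha>]) (use assms in auto)
  obtain r k where rk: "\<lceil>a\<rceil> \<le> r" "r < \<lceil>a\<rceil> + n"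
      "\<bar>of_int r * \<alpha> - of_int k - x\<bar> \<le> 1 / of_int n + \<bar>of_int n * \<alpha> - of_int p\<bar>"
    by (rule inhomogeneous_approx_in_block[OF np(1,2), of "\<lceil>a\<rceil>" \<alpha> x]) blast
  have "\<kappa> \<le> of_int n * \<parallel>of_int n * \<alpha>\<parallel>" using kappa[of n] np(2) by simp
  also have "\<dots> \<le> of_int n * (4 / L)"
    using np(2,4) dist_nearest_int_le[of "of_int n * \<alpha>" p] by (intro mult_left_mono) auto
  finally have "1 / of_int n \<le> 4 / (\<kappa> * L)" using kappa_pos np(2) assms by (simp add: field_simps)
  moreover have "4 / L \<le> 2 / (\<kappa> * L)" using kappa_le_half kappa_pos assms by (simp add: field_simps)
  moreover have "\<bar>of_int n * \<alpha> - of_int p\<bar> < 4 / L" using np(4) by simp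
  ultimately have "\<bar>of_int r * \<alpha> - of_int k - x\<bar> \<le> 4 / (\<kappa> * L) + 2 / (\<kappa> * L)" using rk(3) by linarith
  also have "\<dots> = 6 / (\<kappa> * L)" by (simp flip: add_divide_distrib)
  finally show ?thesis using that[of r k] rk(1,2) np(3) assms by linarith
qed

text \<open>The cube of \<kappa> comes from the overlap for indices i before the hit. Closeness of
  \<beta>' to \<beta> covers i \<le> c'\<kappa>L/16. For larger i, a value i w < 3c with w =
  \<parallel>(q - i)\<alpha>\<parallel> must imply L w \<le> \<kappa>/1000, the range controlled by
  \<open>hit_scale_interval\<close>; this asks for 48c \<le> c'\<kappa> * \<kappa>/1000 with c' =
  \<kappa>/10^5.\<close>

lemma extension_exists:
  assumes c: "0 < c" "c \<le> \<kappa> ^ 3 / 10 ^ 10" and \<eta>: "0 < \<eta>" and av: "avoids_from \<alpha> (\<kappa> / 10 ^ 5) \<beta> Q"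
  shows "\<exists>\<beta>' q Q'. extends_by_hit \<alpha> (\<kappa> / 10 ^ 5) c \<eta> \<beta> Q \<beta>' q Q'"
proof -
  define c' where "c' = \<kappa> / 10 ^ 5"
  have c': "0 < c'" "\<kappa> = 100000 * c'" using kappa_pos by (auto simp: c'_def)
  have \<kappa>2: "\<kappa> ^ 2 \<le> 1" using kappa_pos kappa_le_half by (simp add: power_le_one)
  have "\<kappa> ^ 3 = \<kappa> * \<kappa> ^ 2" by (simp add: power_numeral_reduce)
  also have "\<dots> \<le> \<kappa> * 1" by (rule mult_left_mono) (use kappa_pos \<kappa>2 in auto)
  finally have c_small: "100000 * c \<le> c'" "2 * c \<le> 1" using c(2) c' kappa_le_half by auto
  \<comment> \<open>\<open>m\<close> sets the precision of the hit and \<open>L\<close> the distance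
    to \<beta>. With S = 7^m L the interval surviving m rounds has length exactly L.\<close>
  obtain m where m: "(1 / 7) ^ m < \<eta>" using real_arch_pow_inv[of \<eta> "1/7"] \<eta> by auto
  define L where "L = real Q + 4 + 9 / (\<kappa> * \<eta>)"
  have L: "4 \<le> L" "real Q \<le> L" "9 / (\<kappa> * \<eta>) < L" using \<eta> kappa_pos by (auto simp: L_def)
  define S where "S = 7 ^ m * L"
  have LS: "L \<le> S" using mult_right_mono[of 1 "7 ^ m" L] L by (simp add: S_def)
  have S: "1 \<le> S" "S / 7 ^ m = L" using L LS by (linarith, simp add: S_def)
  \<comment> \<open>Tuning y later by up to g = 14c'/\<nu> costs n g \<le> 14c' for n < \<nu>; of
    \<open>e\<close> = 15c' there remains c'.\<close>
  define e where "e = 15 * c'"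
  \<comment> \<open>The horizon: up to distance \<nu> after the hit the choice of q protects the
    orbit points, beyond it the tuning of \<beta>'. It is so far away that the tuning changes q y by
    at most c/7^m.\<close>
  define \<nu> where "\<nu> = 8 * e / c * 7 ^ Suc m * S"
  have e: "0 < e" "1000 * e \<le> \<kappa>" using c' by (auto simp: e_def)
  have \<nu>: "\<nu> * c = 840 * c' * 7 ^ m * S" using c by (simp add: \<nu>_def e_def)
  obtain b where b: "S \<le> b" "b + S / 7 ^ m \<le> 2 * S"
    "\<And>s n. s \<in> {b..b + S / 7 ^ m} \<Longrightarrow> 1 \<le> n \<Longrightarrow> of_int n \<le> s \<Longrightarrow>
        S * \<parallel>of_int n * \<alpha>\<parallel> \<le> \<kappa> / 1000 * 7 ^ m \<Longrightarrow> \<kappa> / 1000 < (s - of_int n) * \<parallel>of_int n * \<alpha>\<parallel>"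
    "\<And>s n. s \<in> {b..b + S / 7 ^ m} \<Longrightarrow> 1 \<le> n \<Longrightarrow> of_int n < \<nu> \<Longrightarrow> e \<le> of_int n * \<parallel>of_int n * \<alpha> - c / s\<parallel>"
    using hit_scale_interval[of c e S m] c(1) c_small e S(1) unfolding \<nu>_def by (metis (no_types, lifting) le_divide_eq_numeral1(1) mult.commute)
  obtain q k where qk: "b \<le> of_int q" "of_int q \<le> b + L" "\<bar>of_int q * \<alpha> - of_int k - \<beta>\<bar> \<le> 6 / (\<kappa> * L)"
    using inhomogeneous_approx_in_interval[OF L(1)] by blast
  have q: "S \<le> of_int q" "of_int q \<le> 2 * S" "of_int q \<in> {b..b + S / 7 ^ m}" using qk b(1,2) unfolding S(2) by auto
  have q1: "1 \<le> real_of_int q" using q(1) S(1) by linarith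
  have \<nu>1: "1 \<le> \<nu>"
  proof -
    have "c * 1 \<le> (840 * c') * (7 ^ m * S)" using c_small c c' mult_mono[of 1 "7 ^ m" 1 S] S(1) by (intro mult_mono) auto
    then have "1 * c \<le> \<nu> * c" using \<nu> by (simp add: algebra_simps)
    then show ?thesis using c by simp
  qed
  obtain \<beta>' where \<beta>': "of_int q * \<alpha> - of_int k + c / of_int q \<le> \<beta>'" "\<beta>' \<le> of_int q * \<alpha> - of_int k + c / of_int q + 14 * c' / \<nu>"
    "\<And>t::int. \<nu> \<le> of_int t \<Longrightarrow> c' \<le> of_int t * \<parallel>of_int t * \<alpha> - \<beta>'\<parallel>"
    by (rule avoiding_point_in_interval[of c' \<nu> "of_int q * \<alpha> - of_int k + c / of_int q"]) (use c' \<nu>1 in auto)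
  define g where "g = 14 * c' / \<nu>"
  have g: "0 < g" "\<nu> * g = 14 * c'" using c' \<nu>1 by (auto simp: g_def)
  have qg: "of_int q * g \<le> c * (1 / 7) ^ m"
  proof -
    have "of_int q * g \<le> 2 * S * g" using q(2) g by (intro mult_right_mono) auto
    also have "\<dots> = 28 * c' * S * c / (\<nu> * c)" using c by (simp add: g_def)
    also have "\<dots> = c / (30 * 7 ^ m)" using c' S(1) unfolding \<nu> by (simp add: field_simps)
    also have "\<dots> \<le> c / 7 ^ m" using c by (intro divide_left_mono) auto
    finally show ?thesis by (simp add: power_divide)
  qed
  define y where "y = \<beta>' - (of_int q * \<alpha> - of_int k)"
  have y: "c / of_int q \<le> y" "y \<le> c / of_int q + g" using \<beta>'(1,2) by (auto simp: y_def g_def)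
  have qy: "c \<le> of_int q * y" "of_int q * y \<le> c + c * (1 / 7) ^ m"
  proof -
    have "of_int q * (c / of_int q) \<le> of_int q * y" by (rule mult_left_mono) (use y q1 in auto)
    moreover have "of_int q * y \<le> of_int q * (c / of_int q + g)" by (rule mult_left_mono) (use y q1 in auto)
    moreover have "of_int q * (c / of_int q) = c" using q1 by simp
    ultimately show "c \<le> of_int q * y" "of_int q * y \<le> c + c * (1 / 7) ^ m"
      using qg unfolding distrib_left by linarith+
  qed
  have "c * (1 / 7) ^ m \<le> c * 1" using c by (intro mult_left_mono) (auto simp: power_le_one)
  then have qy2: "of_int q * y \<le> 2 * c" using qy by linarith
  have ypos: "0 < y" using y(1) c(1) q1 by (smt (verit) divide_pos_pos)
  have yS: "y \<le> 2 * c / S"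
  proof -
    have "S * y \<le> of_int q * y" using q(1) ypos by (intro mult_right_mono) auto
    then show ?thesis using qy2 S(1) by (simp add: field_simps)
  qed
  have shift: "\<parallel>of_int i * \<alpha> - \<beta>'\<parallel> = \<parallel>of_int (i - q) * \<alpha> - y\<parallel>" for i :: int
    by (rule dist_nearest_int_cong[of _ _ k]) (simp add: y_def algebra_simps)
  have dist: "\<bar>\<beta>' - \<beta>\<bar> \<le> 8 / (\<kappa> * L)"
  proof -
    have "2 * c / S \<le> 2 * c / L" using LS L c by (intro divide_left_mono) auto
    also have "\<dots> \<le> 2 / (\<kappa> * L)" 
    proof -
      have "c * \<kappa> \<le> 1 * 1" using c c_small kappa_pos kappa_le_half by (intro mult_mono) auto
      then show ?thesis using kappa_pos L by (simp add: field_simps)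
    qed
    finally have "y \<le> 2 / (\<kappa> * L)" using yS by (rule order_trans[rotated])
    then have "\<bar>of_int q * \<alpha> - of_int k - \<beta>\<bar> + \<bar>y\<bar> \<le> 6 / (\<kappa> * L) + 2 / (\<kappa> * L)"
      using ypos qk(3) by (intro add_mono) auto
    moreover have "\<bar>\<beta>' - \<beta>\<bar> \<le> \<bar>of_int q * \<alpha> - of_int k - \<beta>\<bar> + \<bar>y\<bar>" unfolding y_def by linarith
    ultimately have "\<bar>\<beta>' - \<beta>\<bar> \<le> 6 / (\<kappa> * L) + 2 / (\<kappa> * L)" by (rule order_trans[rotated])
    then show ?thesis by (simp flip: add_divide_distrib)
  qed
  have hit: "\<parallel>of_int q * \<alpha> - \<beta>'\<parallel> = y"
  proof -
    have "1 * y \<le> of_int q * y" using q1 ypos by (intro mult_right_mono) auto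
    then have "\<bar>y\<bar> \<le> 1 / 2" using qy2 c_small c' kappa_le_half ypos by linarith
    then show ?thesis using shift[of q] dist_nearest_int_eq_abs[of y] ypos by simp
  qed
  have future: "c' \<le> of_int i * \<parallel>of_int i * \<alpha> - \<beta>'\<parallel>" if i: "q < i" for i
  proof (cases "of_int (i - q) < \<nu>")
    case True
    define n where "n = i - q"
    have n: "1 \<le> n" "of_int n < \<nu>" "of_int n \<le> real_of_int i" using i True q1 by (auto simp: n_def)
    have "e \<le> of_int n * \<parallel>of_int n * \<alpha> - c / of_int q\<parallel>" by (rule b(4)[OF q(3) n(1,2)])
    also have "\<dots> \<le> of_int n * (\<parallel>of_int n * \<alpha> - y\<parallel> + g)"
      using dist_nearest_int_diff_ge[of "of_int n * \<alpha> - c / of_int q" "of_int n * \<alpha> - y"] y n by (intro mult_left_mono) auto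
    also have "\<dots> = of_int n * \<parallel>of_int n * \<alpha> - y\<parallel> + of_int n * g" by (simp add: distrib_left)
    also have "of_int n * g \<le> \<nu> * g" using n g by (intro mult_right_mono) auto
    finally have "c' \<le> of_int n * \<parallel>of_int n * \<alpha> - y\<parallel>" using g by (simp add: e_def)
    also have "\<dots> \<le> of_int i * \<parallel>of_int n * \<alpha> - y\<parallel>" using n by (intro mult_right_mono) auto
    finally show ?thesis using shift[of i] by (simp add: n_def)
  next
    case False
    then have "\<nu> \<le> of_int i" using q1 by simp
    then show ?thesis by (rule \<beta>'(3))
  qed
  have past: "c \<le> of_int i * \<parallel>of_int i * \<alpha> - \<beta>'\<parallel>" if i: "int Q \<le> i" "i < q" "0 < i" for i
  proof (cases "of_int i \<le> c' * (\<kappa> * L) / 16")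
    case True
    have "Q \<le> nat i" using i by linarith
    then have "c' \<le> real (nat i) * \<parallel>real (nat i) * \<alpha> - \<beta>\<parallel>" using av unfolding avoids_from_def c'_def by blast
    then have "c' \<le> of_int i * \<parallel>of_int i * \<alpha> - \<beta>\<parallel>" using i(3) by simp
    also have "\<dots> \<le> of_int i * (\<parallel>of_int i * \<alpha> - \<beta>'\<parallel> + 8 / (\<kappa> * L))"
      using dist_nearest_int_diff_ge[of "of_int i * \<alpha> - \<beta>" "of_int i * \<alpha> - \<beta>'"] dist i(3) by (intro mult_left_mono) auto
    also have "\<dots> = of_int i * \<parallel>of_int i * \<alpha> - \<beta>'\<parallel> + of_int i * (8 / (\<kappa> * L))" by (simp add: distrib_left)
    also have "of_int i * (8 / (\<kappa> * L)) \<le> c' * (\<kappa> * L) / 16 * (8 / (\<kappa> * L))" using True kappa_pos L by (intro mult_right_mono) auto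
    also have "\<dots> = c' / 2" using kappa_pos L by simp
    finally show ?thesis using c_small c by linarith
  next
    case False
    define n where "n = q - i"
    have n: "1 \<le> n" "of_int n \<le> real_of_int q" using i by (auto simp: n_def)
    define w where "w = \<parallel>of_int n * \<alpha>\<parallel>"
    have w0: "w \<ge> 0" by (simp add: w_def)
    have "w = \<parallel>of_int (i - q) * \<alpha>\<parallel>"
      using dist_nearest_int_minus[of "of_int n * \<alpha>"] by (simp add: w_def n_def algebra_simps)
    then have wy: "w - y \<le> \<parallel>of_int i * \<alpha> - \<beta>'\<parallel>"
      using dist_nearest_int_diff_ge[of "of_int (i - q) * \<alpha>" "of_int (i - q) * \<alpha> - y"] ypos shift[of i] by simp
    have "3 * c \<le> of_int i * w"
    proof (rule ccontr)
      assume "\<not> ?thesis"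
      then have small: "of_int i * w < 3 * c" by simp
      have "c' * (\<kappa> * L) / 16 * w \<le> of_int i * w" using False w0 by (intro mult_right_mono) auto
      then have "c' * \<kappa> * (L * w) \<le> 48 * c" using small by (simp add: algebra_simps)
      also have "\<dots> \<le> c' * \<kappa> * (\<kappa> / 1000)" using c by (simp add: c'_def power_numeral_reduce algebra_simps)
      finally have "L * w \<le> \<kappa> / 1000" by (rule mult_left_le_imp_le) (use c' kappa_pos in simp)
      then have "7 ^ m * (L * w) \<le> 7 ^ m * (\<kappa> / 1000)" by (intro mult_left_mono) auto
      then have "S * w \<le> \<kappa> / 1000 * 7 ^ m" by (simp add: S_def algebra_simps)
      then have "\<kappa> / 1000 < (of_int q - of_int n) * w" using b(3)[OF q(3) n(1,2)] by (simp add: w_def)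
      then have "\<kappa> / 1000 < of_int i * w" by (simp add: n_def)
      then show False using small c_small c' by linarith
    qed
    moreover have "of_int i * y \<le> of_int q * y" using i ypos by (intro mult_right_mono) auto
    ultimately have "c \<le> of_int i * (w - y)" using qy2 by (simp add: algebra_simps)
    also have "\<dots> \<le> of_int i * \<parallel>of_int i * \<alpha> - \<beta>'\<parallel>" using wy i by (intro mult_left_mono) auto
    finally show ?thesis .
  qed
  have Qq: "int Q \<le> q" using L LS q(1) by linarith
  have "extends_by_hit \<alpha> c' c \<eta> \<beta> Q \<beta>' (nat q) (Suc (nat q))"
    unfolding extends_by_hit_def avoids_from_def
  proof (intro conjI allI impI ballI)
    have "8 / (\<kappa> * L) < \<eta>" using L \<eta> kappa_pos by (simp add: field_simps)
    then show "\<bar>\<beta>' - \<beta>\<bar> < \<eta>" using dist by linarith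
    show "Q \<le> nat q" "nat q < Suc (nat q)" using Qq by auto
    have "c * (1 / 7) ^ m \<le> 1 * (1 / 7) ^ m" using c_small c by (intro mult_right_mono) auto
    then have "\<bar>of_int q * y - c\<bar> < \<eta>" using qy m by linarith
    then show "\<bar>real (nat q) * \<parallel>real (nat q) * \<alpha> - \<beta>'\<parallel> - c\<bar> < \<eta>" using hit q1 by simp
    fix i
    show "c' \<le> real i * \<parallel>real i * \<alpha> - \<beta>'\<parallel>" if "Suc (nat q) \<le> i" using future[of "int i"] that by simp
  next
    fix i assume i: "i \<in> {Q..<Suc (nat q)} - {nat q}"
    show "c \<le> real i * \<parallel>real i * \<alpha> - \<beta>'\<parallel>"
    \<comment> \<open>Index 0 would violate the bound, but it cannot lie in the range: Q = 0
      together with \<open>av\<close> at index 0 would say that a positive constant is at most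
      0.\<close>
    proof (cases "i = 0")
      case True
      then have "Q \<le> 0" using i by simp
      from av[unfolded avoids_from_def, rule_format, OF this] show ?thesis using kappa_pos by simp
    next
      case False
      have "int Q \<le> int i" "int i < q" "0 < int i" using i False by auto
      from past[OF this] show ?thesis by simp
    qed
  qed
  then show ?thesis unfolding c'_def by blast
qed

lemma interval_subset_S_plus: "{0..ereal (\<kappa> ^ 3 / 10 ^ 10)} \<subseteq> S_plus \<alpha>"
proof -
  obtain x where "\<And>t::int. 1 \<le> real_of_int t \<Longrightarrow> \<kappa> / 10 ^ 5 \<le> of_int t * \<parallel>of_int t * \<alpha> - x\<parallel>"
    by (rule avoiding_point_in_interval[of "\<kappa> / 10 ^ 5" 1 0]) (use kappa_pos in auto)
  then have "\<kappa> / 10 ^ 5 \<le> of_int (int i) * \<parallel>of_int (int i) * \<alpha> - x\<parallel>" if "1 \<le> i" for i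
    using that by (metis of_int_of_nat_eq of_nat_1 of_nat_le_iff)
  then have start: "avoids_from \<alpha> (\<kappa> / 10 ^ 5) x 1" by (simp add: avoids_from_def)
  show ?thesis
    by (rule interval_subset_S_plus_if_extensions[OF _ start extension_exists]) (use kappa_pos in simp)
qed

end

subsection \<open>Well approximable numbers\<close>

lemma dist_nearest_int_scaled_le:
  "\<parallel>of_int n * x\<parallel> \<le> \<bar>of_int n\<bar> * \<parallel>of_int t * \<alpha> - x\<parallel> + \<bar>of_int t\<bar> * \<parallel>of_int n * \<alpha>\<parallel>"
proof -
  have "\<parallel>of_int n * x\<parallel> = \<parallel>of_int t * (of_int n * \<alpha>) - of_int n * (of_int t * \<alpha> - x)\<parallel>"
    by (rule dist_nearest_int_cong[of _ _ 0]) (simp add: algebra_simps)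
  also have "\<dots> \<le> \<parallel>of_int t * (of_int n * \<alpha>)\<parallel> + \<parallel>of_int n * (of_int t * \<alpha> - x)\<parallel>"
    by (rule dist_nearest_int_triangle_diff)
  finally show ?thesis
    using dist_nearest_int_mult_le[of t "of_int n * \<alpha>"] dist_nearest_int_mult_le[of n "of_int t * \<alpha> - x"] by linarith
qed

text \<open>By duality it suffices to keep \<open>\<parallel>nx\<parallel>\<close> away from \<open>0\<close> for one Dirichlet denominator \<open>n\<close> per scale:
  if \<open>\<parallel>n\<alpha>\<parallel>\<close> is small compared with \<open>1/t\<close>, then \<open>n \<parallel>t\<alpha> - x\<parallel> \<ge> \<parallel>nx\<parallel> - t \<parallel>n\<alpha>\<parallel>\<close> is bounded below.\<close>

lemma avoiding_point_in_interval_general: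
  fixes \<alpha> a L N :: real
  assumes L: "0 < L" "L \<le> 1/20" and N: "1 \<le> N"
    and below: "\<And>t::int. 1 \<le> t \<Longrightarrow> of_int t < N \<Longrightarrow> 1 / (2 * N) \<le> \<parallel>of_int t * \<alpha>\<parallel>"
  obtains x where "a \<le> x" "x \<le> a + L / N" "\<And>t::int. N \<le> of_int t \<Longrightarrow> (L / 20)\<^sup>2 / 80 \<le> of_int t * \<parallel>of_int t * \<alpha> - x\<parallel>"
proof -
  \<comment> \<open>The ratio 10 = 3 * 3 + 1 allows three bad sets per scale.\<close>
  define X where "X i = 10 ^ i * N" for i :: nat
  have X: "1 \<le> X i" "X (Suc i) = 10 * X i" "0 < X i" for i
  proof -
    show "1 \<le> X i" using mult_mono[of 1 "10 ^ i" 1 N] N by (simp add: X_def)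
    then show "0 < X i" by linarith
  qed (simp add: X_def)
  have X_mono: "X i \<le> X j" if "i \<le> j" for i j
    unfolding X_def using that N by (intro mult_right_mono power_increasing) auto
  have "\<forall>i. \<exists>n p. coprime n p \<and> 0 < n \<and> of_int n \<le> X i \<and> \<bar>of_int n * \<alpha> - of_int p\<bar> < 2 / X i"
    using dirichlet_coprime_int X(1) by metis
  then obtain n p where np: "\<And>i. coprime (n i) (p i)" "\<And>i. 0 < n i" "\<And>i. of_int (n i) \<le> X i"
    "\<And>i. \<bar>of_int (n i) * \<alpha> - of_int (p i)\<bar> < 2 / X i" by metis
  have D: "\<parallel>of_int (n i) * \<alpha>\<parallel> < 2 / X i" for i
    using dist_nearest_int_le[of "of_int (n i) * \<alpha>" "p i"] np(4)[of i] by linarith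
  \<comment> \<open>By \<open>below\<close>, a denominator under N would have
    \<parallel>n\<alpha>\<parallel> \<ge> 1/(2N), more than the Dirichlet bound 1/(5N) available for
    j \<ge> 1. So each of these denominators belongs to one of the scales.\<close>
  have n_ge: "N \<le> of_int (n j)" if "1 \<le> j" for j
  proof (rule ccontr)
    assume "\<not> ?thesis"
    then have "1 / (2 * N) \<le> \<parallel>of_int (n j) * \<alpha>\<parallel>" using below np(2)[of j] by simp
    also have "\<dots> < 2 / X j" by (rule D)
    also have "\<dots> \<le> 2 / X 1" using X_mono[OF that] X by (intro divide_left_mono) auto
    finally show False using N by (simp add: X_def field_simps)
  qed
  \<comment> \<open>A later denominator that is still small must be a multiple u n_i, since
    otherwise it stays 1/(2 n_i) away from the integers. Its numerator is then u p_i, and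
    coprimality forces u = 1.\<close>
  have n_eq: "n j = n i" if "i < j" "of_int (n j) \<le> X i / 10" for i j
  proof -
    define d where "d = \<bar>of_int (n i) * \<alpha> - of_int (p i)\<bar>"
    have d: "d < 2 / X i" "0 \<le> d" using np(4) by (auto simp: d_def)
    have "of_int (n j) * d \<le> X i / 10 * (2 / X i)"
      using that(2) d np(2)[of j] X(3)[of i] by (intro mult_mono) auto
    then have nd: "of_int (n j) * d \<le> 1/5" using X(3)[of i] by simp
    have "10 * X i \<le> X j" using X_mono[of "Suc i" j] X(2)[of i] that(1) by simp
    then have "2 / X j \<le> 2 / (10 * X i)" using X(3) by (intro divide_left_mono) auto
    then have Dj: "\<bar>of_int (n j) * \<alpha> - of_int (p j)\<bar> < 1 / (5 * X i)" using np(4)[of j] by simp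
    have "n i dvd n j"
    proof (rule ccontr)
      assume "\<not> n i dvd n j"
      then have "1 / (2 * of_int (n i)) \<le> \<parallel>of_int (n j) * \<alpha>\<parallel>"
        using nd np(2)[of j] by (intro dist_nearest_int_not_dvd[OF np(1) np(2)]) (auto simp: d_def)
      also have "\<dots> < 1 / (5 * X i)"
        using dist_nearest_int_le[of "of_int (n j) * \<alpha>" "p j"] Dj by linarith
      also have "\<dots> \<le> 1 / (2 * of_int (n i))"
        using np(2)[of i] np(3)[of i] X(3)[of i] by (intro divide_left_mono) auto
      finally show False by simp
    qed
    then obtain u where u: "n j = n i * u" by blast
    have u0: "0 < u" using u np(2)[of i] np(2)[of j] by (simp add: zero_less_mult_iff)
    have "of_int u * d \<le> of_int (n j) * d" unfolding u using np(2)[of i] u0 d by (intro mult_right_mono) auto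
    then have ud: "\<bar>of_int u * (of_int (n i) * \<alpha> - of_int (p i))\<bar> \<le> 1/5" using nd u0 by (simp add: abs_mult d_def)
    have "1 / (5 * X i) \<le> 1/5" using X(1)[of i] by simp
    moreover have "of_int u * (of_int (n i) * \<alpha> - of_int (p i)) - (of_int (n j) * \<alpha> - of_int (p j)) = real_of_int (p j - u * p i)"
      by (simp add: u algebra_simps)
    ultimately have "\<bar>real_of_int (p j - u * p i)\<bar> < 1" using ud Dj by linarith
    then have "p j = u * p i" by linarith
    then have "u dvd 1" using np(1)[of j] u by (metis coprime_common_divisor dvd_triv_left dvd_triv_right)
    then show ?thesis using u u0 by simp
  qed
  \<comment> \<open>L \<le> 1/20 keeps k|x - y| \<le> 10L \<le> 1/2, so the interval meets the bad
    strip of only one integer; \<epsilon> = L/20 makes that strip no wider than the next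
    interval.\<close>
  define \<epsilon> where "\<epsilon> = L / 20"
  have \<epsilon>: "0 < \<epsilon>" "20 * \<epsilon> = L" "\<epsilon> \<le> 1" using L by (auto simp: \<epsilon>_def)
  define l where "l i = L / X i" for i
  define W where "W i j = {x. 1 \<le> j \<and> X i \<le> of_int (n j) \<and> of_int (n j) < X (Suc i) \<and> \<parallel>of_int (n j) * x\<parallel> < \<epsilon>}" for i j
  define G where "G i x \<longleftrightarrow> (\<forall>j. x \<notin> W i j)" for i x
  \<comment> \<open>At most three different denominators lie in one scale \<open>[X i, X (i + 1))\<close>, by \<open>n_eq\<close>.\<close>
  have W_cases: "\<exists>k\<in>{i, Suc i, Suc (Suc i)}. x \<in> W i k" if "x \<in> W i j" for x i j
  proof -
    have "i \<le> j"
    proof (rule ccontr)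
      assume "\<not> ?thesis"
      then have "X (Suc j) \<le> X i" using X_mono[of "Suc j" i] by simp
      then show False using that np(3)[of j] X(2,3)[of j] by (auto simp: W_def)
    qed
    show ?thesis
    proof (cases "j \<le> Suc (Suc i)")
      case True
      then have "j \<in> {i, Suc i, Suc (Suc i)}" using \<open>i \<le> j\<close> by auto
      then show ?thesis using that by blast
    next
      case False
      then have "n j = n (Suc (Suc i))" using that X(2)[of "Suc i"] by (intro n_eq) (auto simp: W_def)
      then have "x \<in> W i (Suc (Suc i))" using that by (simp add: W_def)
      then show ?thesis by blast
    qed
  qed
  have l: "l i \<ge> 0" for i using X(3)[of i] L by (simp add: l_def)
  have lS: "l i = real 10 * l (Suc i)" "0 < l (Suc i)" for i using X(2)[of i] X(3) L by (auto simp: l_def)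
  have diam: "\<bar>x - y\<bar> \<le> l (Suc i)"
    if xy: "x \<in> W i j" "y \<in> W i j" "x \<in> {b..b + real 10 * l (Suc i)}" "y \<in> {b..b + real 10 * l (Suc i)}" for x y b i j
  proof -
    define k where "k = real_of_int (n j)"
    have k: "X i \<le> k" "k < 10 * X i" "\<parallel>k * x\<parallel> < \<epsilon>" "\<parallel>k * y\<parallel> < \<epsilon>" using xy(1,2) X(2)[of i] by (auto simp: W_def k_def)
    have k0: "0 < k" using k(1) X(3)[of i] by linarith
    have "\<bar>x - y\<bar> \<le> l i" using xy(3,4) lS[of i] by (simp add: abs_le_iff)
    then have "k * \<bar>x - y\<bar> \<le> 10 * X i * l i" using k k0 by (intro mult_mono) auto
    also have "\<dots> = 10 * L" using X(3)[of i] by (simp add: l_def)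
    finally have "\<bar>k * (x - y)\<bar> \<le> 1/2" using L k0 by (simp add: abs_mult)
    then have "\<bar>k * (x - y)\<bar> = \<parallel>k * x - k * y\<parallel>" using dist_nearest_int_eq_abs by (simp add: right_diff_distrib)
    also have "\<dots> \<le> 2 * \<epsilon>" using dist_nearest_int_triangle_diff[of "k * x" "k * y"] k by linarith
    finally have "k * \<bar>x - y\<bar> \<le> 2 * \<epsilon>" using k0 by (simp add: abs_mult)
    moreover have "X i * \<bar>x - y\<bar> \<le> k * \<bar>x - y\<bar>" using k by (intro mult_right_mono) auto
    ultimately have "X i * \<bar>x - y\<bar> \<le> L / 10" using \<epsilon> by linarith
    then show ?thesis using X(2,3)[of i] by (simp add: l_def field_simps)
  qed
  obtain x where x: "x \<in> {a..a + l 0}" "\<And>i. G i x"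
  proof (rule nested_interval_game_limit[where l=l and G=G and a=a, OF l])
    fix i b
    have "card (W i ` {i, Suc i, Suc (Suc i)}) \<le> card {i, Suc i, Suc (Suc i)}" by (rule card_image_le) simp
    then have card: "3 * card (W i ` {i, Suc i, Suc (Suc i)}) + 1 \<le> 10" by simp
    obtain b' where b': "b \<le> b'" "b' + l (Suc i) \<le> b + real 10 * l (Suc i)"
      "\<And>V x. V \<in> W i ` {i, Suc i, Suc (Suc i)} \<Longrightarrow> x \<in> {b'..b' + l (Suc i)} \<Longrightarrow> x \<notin> V"
    proof (rule subinterval_avoiding_finite[OF lS(2) _ card, of b])
      show "\<bar>x - y\<bar> \<le> l (Suc i)" if xy: "V \<in> W i ` {i, Suc i, Suc (Suc i)}" "x \<in> V" "y \<in> V"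
        "x \<in> {b..b + real 10 * l (Suc i)}" "y \<in> {b..b + real 10 * l (Suc i)}" for V x y
      proof -
        obtain j where "V = W i j" using xy(1) by blast
        then show ?thesis using diam[of x i j y b] xy by blast
      qed
    qed (simp, rule that)
    have "G i x" if "x \<in> {b'..b' + l (Suc i)}" for x
      unfolding G_def using W_cases b'(3)[OF _ that] by blast
    then show "\<exists>b'\<ge>b. b' + l (Suc i) \<le> b + l i \<and> (\<forall>x\<in>{b'..b' + l (Suc i)}. G i x)"
      using b'(1,2) lS(1)[of i] by (intro exI[of _ b']) simp
  qed blast
  have x_avoids: "\<epsilon> \<le> \<parallel>of_int (n j) * x\<parallel>" if "1 \<le> j" for j
  proof -
    have "1 \<le> of_int (n j) / N" using n_ge[OF that] N by simp
    then obtain i where "10 ^ i \<le> of_int (n j) / N" "of_int (n j) / N < 10 ^ Suc i" by (rule power_bracket[of _ 10]) auto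
    then have "X i \<le> of_int (n j)" "of_int (n j) < X (Suc i)" using N by (simp_all add: X_def field_simps)
    then show ?thesis using x(2)[of i] that unfolding G_def W_def by (auto simp: not_less)
  qed
  show ?thesis
  proof (rule that[of x])
    show "a \<le> x" "x \<le> a + L / N" using x(1) by (auto simp: l_def X_def)
    fix t :: int assume t: "N \<le> of_int t"
    then have t0: "0 < real_of_int t" using N by linarith
    have "\<epsilon> * N \<le> 1 * of_int t" using \<epsilon> t N by (intro mult_mono) auto
    \<comment> \<open>The scale is chosen with X_(i+1) between 4t/\<epsilon> and 40t/\<epsilon>: the
      lower bound yields t\<parallel>k\<alpha>\<parallel> \<le> \<epsilon>/2, the upper one the
      final constant \<epsilon>^2/80.\<close>
    then have "1 \<le> 4 * of_int t / (\<epsilon> * N)" using \<epsilon> N t0 by (simp add: field_simps)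
    then obtain i where i: "10 ^ i \<le> 4 * of_int t / (\<epsilon> * N)" "4 * of_int t / (\<epsilon> * N) < 10 ^ Suc i"
      by (rule power_bracket[of _ 10]) auto
    define k where "k = n (Suc i)"
    have k: "0 < k" "real_of_int k \<le> X (Suc i)" "\<parallel>of_int k * \<alpha>\<parallel> < 2 / X (Suc i)" "\<epsilon> \<le> \<parallel>of_int k * x\<parallel>"
      using np(2,3) D x_avoids by (auto simp: k_def)
    have Xi: "\<epsilon> * X (Suc i) \<le> 40 * of_int t" "4 * of_int t \<le> \<epsilon> * X (Suc i)"
      using i \<epsilon> N by (simp_all add: X_def field_simps)
    have "of_int t * \<parallel>of_int k * \<alpha>\<parallel> \<le> of_int t * (2 / X (Suc i))" using k t0 by (intro mult_left_mono) auto
    also have "\<dots> \<le> \<epsilon> / 2" using Xi(2) X(3)[of "Suc i"] by (simp add: field_simps)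
    finally have "\<epsilon> / 2 \<le> of_int k * \<parallel>of_int t * \<alpha> - x\<parallel>"
      using dist_nearest_int_scaled_le[of k x t \<alpha>] k t0 by simp
    also have "\<dots> \<le> X (Suc i) * \<parallel>of_int t * \<alpha> - x\<parallel>" using k by (intro mult_right_mono) auto
    finally have "\<epsilon> * (\<epsilon> / 2) \<le> \<epsilon> * (X (Suc i) * \<parallel>of_int t * \<alpha> - x\<parallel>)" using \<epsilon> by (intro mult_left_mono) auto
    also have "\<dots> = (\<epsilon> * X (Suc i)) * \<parallel>of_int t * \<alpha> - x\<parallel>" by simp
    also have "\<dots> \<le> 40 * of_int t * \<parallel>of_int t * \<alpha> - x\<parallel>" using Xi by (intro mult_right_mono) auto
    finally show "(L / 20)\<^sup>2 / 80 \<le> of_int t * \<parallel>of_int t * \<alpha> - x\<parallel>" by (simp add: \<epsilon>_def power2_eq_square)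
  qed
qed

locale well_approximable =
  fixes \<alpha> :: real
  assumes irrational: "\<alpha> \<notin> \<rat>"
    and well_approx: "\<And>\<kappa>. 0 < \<kappa> \<Longrightarrow> \<exists>t::int. 1 \<le> t \<and> of_int t * \<parallel>of_int t * \<alpha>\<parallel> < \<kappa>"
begin

text \<open>Cancelling the gcd decreases both factors of the product. Asking the product to lie
  below a lower bound d for \<parallel>t\<alpha>\<parallel> on 1 \<le> t \<le> X pushes n beyond
  X.\<close>

lemma excellent_denominator:
  fixes \<kappa> X :: real
  assumes "0 < \<kappa>"
  obtains n p :: int where "coprime n p" "0 < n" "X < of_int n" "0 < \<bar>of_int n * \<alpha> - of_int p\<bar>"
    "of_int n * \<bar>of_int n * \<alpha> - of_int p\<bar> < \<kappa>"
proof -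
  obtain d where d: "d > 0" "\<And>t::int. 1 \<le> t \<Longrightarrow> of_int t \<le> X \<Longrightarrow> d \<le> \<parallel>of_int t * \<alpha>\<parallel>"
    by (rule dist_nearest_int_bounded_below[OF irrational, of X]) blast
  obtain t :: int where t: "1 \<le> t" "of_int t * \<parallel>of_int t * \<alpha>\<parallel> < min \<kappa> d"
    using well_approx[of "min \<kappa> d"] assms d by auto
  obtain k where k: "\<parallel>of_int t * \<alpha>\<parallel> = \<bar>of_int t * \<alpha> - of_int k\<bar>" using dist_nearest_int_ex by blast
  define g where "g = gcd t k"
  have g: "1 \<le> g" using t by (simp add: g_def int_one_le_iff_zero_less)
  obtain n p where np: "t = g * n" "k = g * p" "coprime n p"
    using gcd_coprime_exists[of t k] g unfolding g_def by (metis mult.commute gcd_eq_0_iff not_one_le_zero)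
  define \<delta> where "\<delta> = \<bar>of_int n * \<alpha> - of_int p\<bar>"
  have n0: "0 < n" using np t g by (smt (verit) zero_less_mult_iff)
  have g1: "1 \<le> real_of_int g" using g by simp
  have "of_int n \<le> real_of_int t" using mult_right_mono[OF g1, of "of_int n"] n0 np by simp
  moreover have "\<delta> \<le> \<parallel>of_int t * \<alpha>\<parallel>"
  proof -
    have "\<bar>of_int t * \<alpha> - of_int k\<bar> = \<bar>of_int g * (of_int n * \<alpha> - of_int p)\<bar>" by (simp add: np algebra_simps)
    also have "\<dots> = of_int g * \<delta>" using g1 by (simp add: abs_mult \<delta>_def)
    finally show ?thesis using mult_right_mono[OF g1, of \<delta>] k by (simp add: \<delta>_def)
  qed
  ultimately have "of_int n * \<delta> \<le> of_int t * \<parallel>of_int t * \<alpha>\<parallel>"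
    using n0 by (intro mult_mono) (auto simp: \<delta>_def)
  then have n\<delta>: "of_int n * \<delta> < \<kappa>" "of_int n * \<delta> < d" using t by auto
  have pos: "0 < \<delta>"
    using dist_nearest_int_pos[OF irrational, of n] dist_nearest_int_le[of "of_int n * \<alpha>" p] n0 by (simp add: \<delta>_def)
  have "X < of_int n"
  proof (rule ccontr)
    assume "\<not> ?thesis"
    then have "d \<le> \<parallel>of_int n * \<alpha>\<parallel>" using d(2)[of n] n0 by simp
    also have "\<dots> \<le> \<delta>" unfolding \<delta>_def by (rule dist_nearest_int_le)
    also have "\<dots> \<le> of_int n * \<delta>" using mult_right_mono[of 1 "of_int n" \<delta>] n0 pos by simp
    finally show False using n\<delta> by simp
  qed
  then show ?thesis using that[OF np(3) n0] pos n\<delta> by (simp add: \<delta>_def)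
qed

text \<open>The constant of \<open>avoiding_point_in_interval_general\<close> for \<open>L = 1/1024\<close>.\<close>

definition avoidance :: real where "avoidance = (1 / 20480)\<^sup>2 / 80"

lemma avoidance: "0 < avoidance" "avoidance \<le> 1 / 1000000"
  by (auto simp: avoidance_def power2_eq_square)

lemma extension_exists:
  assumes c: "0 < c" "c \<le> avoidance / 4096" and \<eta>: "0 < \<eta>" and av: "avoids_from \<alpha> avoidance \<beta> Q"
  shows "\<exists>\<beta>' q Q'. extends_by_hit \<alpha> avoidance c \<eta> \<beta> Q \<beta>' q Q'"
proof -
  define c' where "c' = avoidance"
  have c': "0 < c'" "c' \<le> 1 / 1000000" "4096 * c \<le> c'" using avoidance c by (auto simp: c'_def)
  obtain d where d: "d > 0" "\<And>t::int. 1 \<le> t \<Longrightarrow> of_int t \<le> 4 / \<eta> \<Longrightarrow> d \<le> \<parallel>of_int t * \<alpha>\<parallel>"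
    by (rule dist_nearest_int_bounded_below[OF irrational, of "4 / \<eta>"]) blast
  define \<kappa> where "\<kappa> = min c \<eta>"
  have \<kappa>: "0 < \<kappa>" "\<kappa> \<le> c" "\<kappa> \<le> \<eta>" using c \<eta> by (auto simp: \<kappa>_def)
  \<comment> \<open>The bound 8/d makes the auxiliary denominator m below exceed 4/\<eta>: it has
    \<parallel>m\<alpha>\<parallel> < 8/n < d. The error 4/m in \<beta> is then admissible.\<close>
  obtain n p where np: "coprime n p" "0 < n" "max (max 64 (real Q * 32)) (8 / d) < of_int n" "0 < \<bar>of_int n * \<alpha> - of_int p\<bar>"
    "of_int n * \<bar>of_int n * \<alpha> - of_int p\<bar> < \<kappa>"
    by (rule excellent_denominator[OF \<kappa>(1)]) blast
  define \<delta> where "\<delta> = \<bar>of_int n * \<alpha> - of_int p\<bar>"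
  define nr where "nr = real_of_int n"
  have nr: "64 < nr" "real Q * 32 < nr" "8 / d < nr" and \<delta>: "0 < \<delta>" "nr * \<delta> < \<kappa>" using np by (auto simp: nr_def \<delta>_def)
  have not_dvd: "1 / (2 * nr) \<le> \<parallel>of_int t * \<alpha>\<parallel>" if "\<not> n dvd t" "\<bar>of_int t\<bar> * \<delta> \<le> 1/2" for t :: int
    using dist_nearest_int_not_dvd[OF np(1,2) that(1)] that(2) by (simp add: nr_def \<delta>_def)
  have dvd: "\<parallel>of_int (n * u) * \<alpha>\<parallel> = of_int u * \<delta>" if "0 \<le> u" "of_int u * \<delta> \<le> 1/2" for u :: int
    using dist_nearest_int_dvd[of u n \<alpha> p] that by (simp add: \<delta>_def)
  have D_ge_\<delta>: "\<delta> \<le> \<parallel>of_int t * \<alpha>\<parallel>" if t: "1 \<le> t" "of_int t * \<delta> \<le> 1/2" for t :: int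
  proof (cases "n dvd t")
    case True
    then obtain u where u: "t = n * u" by blast
    have u0: "1 \<le> u" using u t np(2) by (smt (verit) mult_pos_neg zero_less_mult_iff mult_zero_right)
    have "of_int u \<le> real_of_int t" using mult_right_mono[of 1 "real_of_int n" "of_int u"] np(2) u u0 by simp
    then have "of_int u * \<delta> \<le> of_int t * \<delta>" using \<delta> by (intro mult_right_mono) auto
    then have "of_int u * \<delta> \<le> 1/2" using t(2) by linarith
    then have "\<parallel>of_int t * \<alpha>\<parallel> = of_int u * \<delta>" using dvd[of u] u0 unfolding u by simp
    then show ?thesis using mult_right_mono[of 1 "of_int u" \<delta>] u0 \<delta> by simp
  next
    case False
    have "\<delta> \<le> 1 / (2 * nr)" using \<delta> nr \<kappa> c' by (simp add: field_simps)
    then show ?thesis using not_dvd[OF False] t by simp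
  qed
  \<comment> \<open>Up to N = 1/(2\<delta>) every \<parallel>t\<alpha>\<parallel> is at least
    \<delta> = 1/(2N), which is the condition for avoiding from N on. The length (1/1024)/N equals
    \<delta>/512, so y lies between \<delta>/512 and \<delta>/256.\<close>
  define N where "N = 1 / (2 * \<delta>)"
  have "nr * \<delta> \<ge> 1 * \<delta>" using nr \<delta> by (intro mult_right_mono) auto
  then have \<delta>_small: "\<delta> \<le> 1/2" using \<delta> \<kappa> c' by linarith
  have N1: "1 \<le> N" using \<delta>_small \<delta> by (simp add: N_def field_simps)
  obtain y where y: "\<delta> / 512 \<le> y" "y \<le> \<delta> / 512 + (1 / 1024) / N"
     "\<And>t::int. N \<le> of_int t \<Longrightarrow> ((1 / 1024) / 20)\<^sup>2 / 80 \<le> of_int t * \<parallel>of_int t * \<alpha> - y\<parallel>"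
  proof (rule avoiding_point_in_interval_general[of "1 / 1024" N \<alpha> "\<delta> / 512"])
    fix t :: int assume "1 \<le> t" "of_int t < N"
    then show "1 / (2 * N) \<le> \<parallel>of_int t * \<alpha>\<parallel>" using D_ge_\<delta>[of t] \<delta> by (simp add: N_def field_simps)
  qed (use N1 in auto)
  have y2: "y \<le> \<delta> / 256" using y(2) \<delta> by (simp add: N_def)
  have y3: "c' \<le> of_int t * \<parallel>of_int t * \<alpha> - y\<parallel>" if "N \<le> of_int t" for t :: int
    using y(3)[OF that] by (simp add: c'_def avoidance_def)
  have y0: "0 < y" using y(1) \<delta> by linarith
  have ny: "nr * y < \<kappa> / 256"
  proof -
    have "nr * y \<le> nr * (\<delta> / 256)" using y2 nr by (intro mult_left_mono) auto
    then show ?thesis using \<delta>(2) by simp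
  qed
  \<comment> \<open>q will lie between jn and (j + 1)n, so q y misses c by no more than about one
    step n y < \<kappa>/256.\<close>
  define j where "j = \<lfloor>c / (y * nr)\<rfloor>"
  have j: "of_int j * nr * y \<le> c" "c < (of_int j + 1) * nr * y"
  proof -
    have "of_int j \<le> c / (y * nr)" "c / (y * nr) < of_int j + 1" unfolding j_def by linarith+
    then show "of_int j * nr * y \<le> c" "c < (of_int j + 1) * nr * y" using y0 nr by (simp_all add: field_simps)
  qed
  \<comment> \<open>Since y \<le> \<delta>/256, reaching q y \<approx> c makes jn\<delta> exceed c
    by a large factor. It pays for the losses 1/2 after the hit and 1/64 before it.\<close>
  have jnd: "255 * c \<le> of_int j * nr * \<delta>"
  proof -
    have jny: "c - \<kappa> / 256 \<le> of_int j * nr * y" using j(2) ny by (simp add: algebra_simps)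
    then have "0 \<le> of_int j * nr * y" using \<kappa> c by linarith
    then have "0 \<le> of_int j * nr" using y0 by (simp add: zero_le_mult_iff)
    then have "of_int j * nr * y \<le> of_int j * nr * (\<delta> / 256)" using y2 by (intro mult_left_mono) auto
    then show ?thesis using jny \<kappa> c by simp
  qed
  have j2: "2 \<le> j"
  proof (rule ccontr)
    assume "\<not> ?thesis"
    then have "of_int j * (nr * \<delta>) \<le> 1 * (nr * \<delta>)" using nr \<delta> by (intro mult_right_mono) auto
    then show False using jnd \<delta> \<kappa> c by (simp add: mult.assoc)
  qed
  obtain m h where mh: "coprime m h" "0 < m" "of_int m \<le> nr / 4" "\<bar>of_int m * \<alpha> - of_int h\<bar> < 2 / (nr / 4)"
    by (rule dirichlet_coprime_int[of "nr / 4" \<alpha>]) (use nr in auto)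
  define mr where "mr = real_of_int m"
  define \<mu> where "\<mu> = \<bar>of_int m * \<alpha> - of_int h\<bar>"
  have mr: "1 \<le> mr" "4 * mr \<le> nr" and \<mu>: "\<mu> < 8 / nr" using mh by (auto simp: mr_def \<mu>_def)
  have m\<delta>: "mr * \<delta> \<le> nr * \<delta>" using mr \<delta> nr by (intro mult_right_mono) auto
  have nm: "\<not> n dvd m" using mh(2) mr(2) nr zdvd_imp_le[of n m] by (auto simp: mr_def nr_def)
  have "mr * \<delta> \<le> 1/2" using m\<delta> \<delta> \<kappa> c' by linarith
  then have "1 / (2 * nr) \<le> \<parallel>of_int m * \<alpha>\<parallel>" using not_dvd[OF nm] mh(2) by (simp add: mr_def)
  then have \<mu>_ge: "1 / (2 * nr) \<le> \<mu>"
    using dist_nearest_int_le[of "of_int m * \<alpha>" h] unfolding \<mu>_def by (rule order_trans)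
  have m_large: "4 / mr < \<eta>"
  proof (rule ccontr)
    assume "\<not> ?thesis"
    then have "mr \<le> 4 / \<eta>" using mr \<eta> by (simp add: field_simps)
    then have "d \<le> \<parallel>of_int m * \<alpha>\<parallel>" using d(2)[of m] mh(2) by (simp add: mr_def)
    then have "d < 8 / nr" using \<mu> dist_nearest_int_le[of "of_int m * \<alpha>" h] by (simp add: \<mu>_def)
    then show False using nr d(1) by (simp add: field_simps)
  qed
  \<comment> \<open>If \<open>m\<close> is not too small compared with \<open>n\<close>, closeness to \<open>\<beta>\<close> alone handles all \<open>i < 4cn\<close>.  Otherwise
    \<open>m\<close> is itself an excellent denominator, and \<open>r\<close> has to be so small that \<open>r \<mu> \<le> 1/2\<close>.\<close>
  obtain r k where r: "nr / 32 \<le> of_int r" "of_int r < nr" "\<bar>of_int r * \<alpha> - of_int k - \<beta>\<bar> \<le> 3 / mr"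
    "32 * c * nr \<le> c' * mr \<or> of_int r \<le> nr / 16"
  proof -
    define A where "A = (if 32 * c * nr \<le> c' * mr then \<lceil>nr / 2\<rceil> else \<lceil>nr / 32\<rceil>)"
    obtain r k where rk: "A \<le> r" "r < A + m" "\<bar>of_int r * \<alpha> - of_int k - \<beta>\<bar> \<le> 1 / of_int m + \<mu>"
      unfolding \<mu>_def by (rule inhomogeneous_approx_in_block[OF mh(1,2), of A \<alpha> \<beta>]) blast
    have "8 / nr \<le> 2 / mr" using mr nr by (simp add: field_simps)
    then have "\<bar>of_int r * \<alpha> - of_int k - \<beta>\<bar> \<le> 1 / mr + 2 / mr" using rk(3) \<mu> unfolding mr_def[symmetric] by linarith
    then have close: "\<bar>of_int r * \<alpha> - of_int k - \<beta>\<bar> \<le> 3 / mr" by (simp flip: add_divide_distrib)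
    have rA: "real_of_int A \<le> of_int r" "of_int r \<le> of_int A + mr - 1" using rk(1,2) unfolding mr_def by linarith+
    show ?thesis
    proof (cases "32 * c * nr \<le> c' * mr")
      case True
      then have "nr / 2 \<le> of_int A" "of_int A < nr / 2 + 1" using True unfolding A_def if_P[OF True] by linarith+
      then show ?thesis using that[of r k] rA mr nr close True by linarith
    next
      case False
      then have A: "nr / 32 \<le> of_int A" "of_int A < nr / 32 + 1" unfolding A_def if_not_P[OF False] by linarith+
      \<comment> \<open>Here the ratio 4096 between c' and c enters: it gives m \<le> n/128, so a
        block of length m that starts at n/32 ends below n/16.\<close>
      have "(4096 * c) * mr \<le> c' * mr" using c' mr by (intro mult_right_mono) auto
      then have "c * (128 * mr) \<le> c * nr" using False by simp
      then have "128 * mr \<le> nr" using c by simp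
      then show ?thesis using that[of r k] rA mr nr close A by linarith
    qed
  qed
  define q where "q = r + j * n"
  define jr where "jr = real_of_int j"
  have jr: "2 \<le> jr" using j2 by (simp add: jr_def)
  have qr: "real_of_int q = of_int r + jr * nr" by (simp add: q_def jr_def nr_def)
  have jnq: "jr * nr \<le> of_int q" "of_int q \<le> (jr + 1) * nr" using qr r nr by (auto simp: algebra_simps)
  have "1 * nr \<le> jr * nr" using jr nr by (intro mult_right_mono) auto
  then have q0: "nr \<le> real_of_int q" "0 < real_of_int q" using jnq nr by linarith+
  have qy: "\<bar>of_int q * y - c\<bar> < \<kappa>"
  proof -
    have "jr * nr * y \<le> of_int q * y" "of_int q * y \<le> (jr + 1) * nr * y" using jnq y0 by (auto intro: mult_right_mono)
    moreover have "(jr + 1) * nr * y = jr * nr * y + nr * y" by (simp add: algebra_simps)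
    ultimately show ?thesis using j ny unfolding jr_def[symmetric] by linarith
  qed
  \<comment> \<open>This ensures t\<delta> \<le> 1/2 for all t \<le> q, so the dichotomy on
    divisibility by n covers every index before the hit.\<close>
  have q\<delta>: "of_int q * \<delta> \<le> 1024 * c"
  proof -
    have "of_int q * (\<delta> / 512) \<le> of_int q * y" using y(1) q0 by (intro mult_left_mono) auto
    then show ?thesis using qy \<kappa> by linarith
  qed
  have j\<delta>: "jr * \<delta> \<le> 1024 * c / nr"
  proof -
    have "jr * nr * \<delta> \<le> of_int q * \<delta>" using jnq \<delta> by (intro mult_right_mono) auto
    then show ?thesis using q\<delta> nr by (simp add: field_simps)
  qed
  have inv_nm: "1 / nr \<le> 1 / (4 * mr)" using mr by (intro divide_left_mono) auto
  have j\<delta>': "jr * \<delta> \<le> 1 / (512 * mr)"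
  proof -
    have "1024 * c / nr \<le> (1 / 128) * (1 / nr)" using nr c' c by (simp add: field_simps)
    also have "\<dots> \<le> (1 / 128) * (1 / (4 * mr))" using inv_nm by (intro mult_left_mono) auto
    finally show ?thesis using j\<delta> by simp
  qed
  have yn: "y \<le> (1 / 256) * (1 / nr)" using ny \<kappa> c' nr by (simp add: field_simps)
  have ym: "y \<le> 1 / (512 * mr)"
  proof -
    have "(1 / 256) * (1 / nr) \<le> (1 / 256) * (1 / (4 * mr))" using inv_nm by (intro mult_left_mono) auto
    also have "\<dots> \<le> 1 / (512 * mr)" using mr by (simp add: field_simps)
    finally show ?thesis using yn by linarith
  qed
  define \<beta>' where "\<beta>' = of_int q * \<alpha> - of_int (k + j * p) + y"
  have shift: "\<parallel>of_int i * \<alpha> - \<beta>'\<parallel> = \<parallel>of_int (i - q) * \<alpha> - y\<parallel>" for i :: int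
    by (rule dist_nearest_int_cong[of _ _ "k + j * p"]) (simp add: \<beta>'_def algebra_simps)
  have dist: "\<bar>\<beta>' - \<beta>\<bar> \<le> 4 / mr"
  proof -
    define u v where "u = of_int r * \<alpha> - of_int k - \<beta>" and "v = jr * (of_int n * \<alpha> - of_int p)"
    have "\<beta>' - \<beta> = u + v + y" by (simp add: u_def v_def \<beta>'_def q_def jr_def algebra_simps)
    then have "\<bar>\<beta>' - \<beta>\<bar> \<le> \<bar>u\<bar> + \<bar>v\<bar> + \<bar>y\<bar>" by linarith
    also have "\<bar>v\<bar> = jr * \<delta>" using jr by (simp add: v_def abs_mult \<delta>_def)
    also have "\<bar>u\<bar> + jr * \<delta> + \<bar>y\<bar> \<le> 3 / mr + 1 / (512 * mr) + 1 / (512 * mr)"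
      using r(3) j\<delta>' ym y0 by (intro add_mono) (auto simp: u_def)
    also have "\<dots> \<le> 4 / mr" using mr by (simp add: field_simps)
    finally show ?thesis .
  qed
  have hit: "\<parallel>of_int q * \<alpha> - \<beta>'\<parallel> = y"
    using shift[of q] dist_nearest_int_eq_abs[of y] y0 y2 \<delta>_small by simp
  have future: "c \<le> of_int i * \<parallel>of_int i * \<alpha> - \<beta>'\<parallel>" "N \<le> of_int (i - q) \<Longrightarrow> c' \<le> of_int i * \<parallel>of_int i * \<alpha> - \<beta>'\<parallel>"
    if i: "q < i" for i
  proof -
    define t where "t = i - q"
    have t: "1 \<le> t" "of_int t \<le> real_of_int i" "real_of_int q \<le> of_int i" using i q0 by (auto simp: t_def)
    have far: "c' \<le> of_int i * \<parallel>of_int i * \<alpha> - \<beta>'\<parallel>" if "N \<le> of_int t"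
    proof -
      have "of_int t * \<parallel>of_int t * \<alpha> - y\<parallel> \<le> of_int i * \<parallel>of_int t * \<alpha> - y\<parallel>" using t by (intro mult_right_mono) auto
      then show ?thesis using y3[OF that] shift[of i] by (simp add: t_def)
    qed
    then show "c' \<le> of_int i * \<parallel>of_int i * \<alpha> - \<beta>'\<parallel>" if "N \<le> of_int (i - q)" using that by (simp add: t_def)
    show "c \<le> of_int i * \<parallel>of_int i * \<alpha> - \<beta>'\<parallel>"
    proof (cases "N \<le> of_int t")
      case True
      then show ?thesis using far c' c by linarith
    next
      case False
      then have "of_int t * \<delta> \<le> 1/2" using \<delta> by (simp add: N_def field_simps)
      then have "\<delta> \<le> \<parallel>of_int t * \<alpha>\<parallel>" using t by (intro D_ge_\<delta>) auto
      then have "\<delta> / 2 \<le> \<parallel>of_int t * \<alpha> - y\<parallel>"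
        using dist_nearest_int_diff_ge[of "of_int t * \<alpha>" "of_int t * \<alpha> - y"] y0 y2 by simp
      moreover have "jr * nr \<le> of_int i" using jnq t by linarith
      moreover have "0 \<le> jr * nr" using jr nr by simp
      ultimately have "jr * nr * (\<delta> / 2) \<le> of_int i * \<parallel>of_int t * \<alpha> - y\<parallel>" using \<delta> by (intro mult_mono) auto
      then show ?thesis using jnd c shift[of i] by (simp add: t_def jr_def)
    qed
  qed
  have past: "c \<le> of_int i * \<parallel>of_int i * \<alpha> - \<beta>'\<parallel>" if i: "int Q \<le> i" "0 < i" "i < q" for i
  proof -
    define t where "t = q - i"
    have t: "1 \<le> t" "of_int t \<le> real_of_int q" using i by (auto simp: t_def)
    have "of_int t * \<delta> \<le> of_int q * \<delta>" using t \<delta> by (intro mult_right_mono) auto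
    then have t\<delta>: "of_int t * \<delta> \<le> 1/2" using q\<delta> c' by linarith
    have "\<parallel>of_int i * \<alpha> - \<beta>'\<parallel> = \<parallel>of_int t * \<alpha> + y\<parallel>"
      using shift[of i] dist_nearest_int_minus[of "of_int t * \<alpha> + y"] by (simp add: t_def algebra_simps)
    then have ty: "\<parallel>of_int t * \<alpha>\<parallel> - y \<le> \<parallel>of_int i * \<alpha> - \<beta>'\<parallel>"
      using dist_nearest_int_add_ge[of "of_int t * \<alpha>" y] y0 by simp
    have ir: "0 < real_of_int i" using i by simp
    show ?thesis
    proof (cases "n dvd t")
      case True
      then obtain u where u: "t = n * u" by blast
      have u1: "1 \<le> u" using u t np(2) by (smt (verit) mult_pos_neg zero_less_mult_iff mult_zero_right)
      define ur where "ur = real_of_int u"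
      have ur: "1 \<le> ur" using u1 by (simp add: ur_def)
      have ieq: "real_of_int i = of_int r + (jr - ur) * nr"
        using u qr by (simp add: t_def ur_def nr_def algebra_simps)
      have "u \<le> j"
      proof (rule ccontr)
        assume "\<not> ?thesis"
        then have "jr - ur \<le> -1" unfolding jr_def ur_def by linarith
        then have "(jr - ur) * nr \<le> (-1) * nr" using nr by (intro mult_right_mono) auto
        then show False using ieq ir r(2) by linarith
      qed
      have "ur * \<delta> \<le> of_int t * \<delta>"
        using mult_right_mono[of 1 nr ur] nr ur \<delta> unfolding u ur_def nr_def by (intro mult_right_mono) auto
      then have "ur * \<delta> \<le> 1/2" using t\<delta> by linarith
      then have "\<parallel>of_int t * \<alpha>\<parallel> = ur * \<delta>" using dvd[of u] u1 unfolding u ur_def by simp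
      moreover have "\<delta> \<le> ur * \<delta>" using mult_right_mono[OF ur, of \<delta>] \<delta> by simp
      ultimately have D: "ur * \<delta> / 2 \<le> \<parallel>of_int i * \<alpha> - \<beta>'\<parallel>" using ty y2 \<delta> by linarith
      \<comment> \<open>As a function of u, the product (r + (j - u)n)u is concave, so only the ends
        matter. At u = j just r j is left, which is why r was kept above n/32.\<close>
      have iu: "jr * nr / 32 \<le> of_int i * ur"
      proof (cases "u = j")
        case True
        then have "of_int i * ur = of_int r * jr" using ieq by (simp add: ur_def jr_def)
        then show ?thesis using mult_right_mono[OF r(1), of jr] jr by (simp add: mult.commute)
      next
        case False
        then have ju: "1 \<le> jr - ur" using \<open>u \<le> j\<close> unfolding jr_def ur_def by linarith
        have "0 \<le> (jr - ur - 1) * (ur - 1)" using ju ur by simp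
        then have "jr - 1 \<le> (jr - ur) * ur" by (simp add: algebra_simps)
        then have "jr / 32 \<le> (jr - ur) * ur" using jr by linarith
        then have "jr / 32 * nr \<le> (jr - ur) * ur * nr" using nr by (intro mult_right_mono) auto
        moreover have "(jr - ur) * nr * ur \<le> of_int i * ur" using ieq r(1) nr ur by (intro mult_right_mono) auto
        ultimately show ?thesis by (simp add: algebra_simps)
      qed
      have "c \<le> jr * nr / 32 * (\<delta> / 2)" using jnd c by (simp add: jr_def)
      also have "\<dots> \<le> of_int i * ur * (\<delta> / 2)" using iu \<delta> by (intro mult_right_mono) auto
      also have "\<dots> = of_int i * (ur * \<delta> / 2)" by simp
      also have "\<dots> \<le> of_int i * \<parallel>of_int i * \<alpha> - \<beta>'\<parallel>" using D ir by (intro mult_left_mono) auto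
      finally show ?thesis .
    next
      case False
      have Dt: "1 / (2 * nr) \<le> \<parallel>of_int t * \<alpha>\<parallel>" using not_dvd[OF False] t\<delta> t by simp
      have D: "1 / (4 * nr) \<le> \<parallel>of_int i * \<alpha> - \<beta>'\<parallel>"
      proof -
        have "1 / (4 * nr) = (1 / 4) * (1 / nr)" "1 / (2 * nr) = (1 / 2) * (1 / nr)" "0 < 1 / nr" using nr by auto
        then show ?thesis using Dt ty yn by linarith
      qed
      show ?thesis
      proof (cases "4 * c * nr \<le> of_int i")
        case True
        have "c = 4 * c * nr * (1 / (4 * nr))" using nr by simp
        also have "\<dots> \<le> of_int i * \<parallel>of_int i * \<alpha> - \<beta>'\<parallel>" using True D ir nr by (intro mult_mono) auto
        finally show ?thesis .
      next
        case small: False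
        show ?thesis
        proof (cases "of_int i \<le> c' * mr / 8")
          case True
          have "Q \<le> nat i" using i by linarith
          then have "c' \<le> real (nat i) * \<parallel>real (nat i) * \<alpha> - \<beta>\<parallel>" using av unfolding avoids_from_def c'_def by blast
          then have "c' \<le> of_int i * \<parallel>of_int i * \<alpha> - \<beta>\<parallel>" using i by simp
          also have "\<dots> \<le> of_int i * (\<parallel>of_int i * \<alpha> - \<beta>'\<parallel> + 4 / mr)"
            using dist_nearest_int_diff_ge[of "of_int i * \<alpha> - \<beta>" "of_int i * \<alpha> - \<beta>'"] dist ir by (intro mult_left_mono) auto
          also have "\<dots> = of_int i * \<parallel>of_int i * \<alpha> - \<beta>'\<parallel> + of_int i * (4 / mr)" by (simp add: distrib_left)
          also have "of_int i * (4 / mr) \<le> c' * mr / 8 * (4 / mr)" using True mr by (intro mult_right_mono) auto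
          also have "\<dots> = c' / 2" using mr by simp
          finally show ?thesis using c c' by linarith
        next
          case large: False
          then have "c' * mr < 32 * c * nr" using small by linarith
          then have r16: "of_int r \<le> nr / 16" using r(4) by linarith
          \<comment> \<open>Dropping jn from t = s + jn changes the distance by at most j\<delta>
            \<le> 1/(512m). What remains is a difference s between n/64 and n/16, short enough for
            the dichotomy modulo m.\<close>
          define s where "s = r - i"
          have "c * nr \<le> 1 / 256 * nr" using c' nr by (intro mult_right_mono) auto
          then have s: "nr / 64 \<le> of_int s" "of_int s \<le> nr / 16" using small r(1) r16 ir unfolding s_def by auto
          have s0: "0 < s" using s nr by linarith
          have "of_int s * \<mu> \<le> nr / 16 * (8 / nr)" using s s0 \<mu> nr by (intro mult_mono) (auto simp: \<mu>_def)
          then have s\<mu>: "of_int s * \<mu> \<le> 1/2" using nr by simp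
          have Ds: "1 / (128 * mr) \<le> \<parallel>of_int s * \<alpha>\<parallel>"
          proof (cases "m dvd s")
            case True
            then obtain v where v: "s = m * v" by blast
            have v0: "0 < v" using v s0 mh(2) by (simp add: zero_less_mult_iff)
            have vm: "of_int v = of_int s / mr" using v mr by (simp add: mr_def)
            have "of_int v * \<mu> \<le> of_int s * \<mu>" using v v0 mh(2) by (intro mult_right_mono) (auto simp: \<mu>_def)
            then have "of_int v * \<mu> \<le> 1/2" using s\<mu> by linarith
            then have "\<parallel>of_int s * \<alpha>\<parallel> = of_int v * \<mu>"
              using dist_nearest_int_dvd[of v m \<alpha> h] v0 unfolding v by (simp add: \<mu>_def)
            also have "\<dots> \<ge> (nr / 64 / mr) * (1 / (2 * nr))"
              unfolding vm using s \<mu>_ge mr nr by (intro mult_mono divide_right_mono) auto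
            also have "(nr / 64 / mr) * (1 / (2 * nr)) = 1 / (128 * mr)" using nr by simp
            finally show ?thesis .
          next
            case False
            then have "1 / (2 * mr) \<le> \<parallel>of_int s * \<alpha>\<parallel>"
              using dist_nearest_int_not_dvd[OF mh(1,2) False, of \<alpha>] s\<mu> s0 by (simp add: mr_def \<mu>_def)
            moreover have "1 / (128 * mr) \<le> 1 / (2 * mr)" using mr by (intro divide_left_mono) auto
            ultimately show ?thesis by linarith
          qed
          have "\<parallel>of_int t * \<alpha>\<parallel> = \<parallel>of_int s * \<alpha> + jr * (of_int n * \<alpha> - of_int p)\<parallel>"
            by (rule dist_nearest_int_cong[of _ _ "j * p"]) (simp add: t_def s_def q_def jr_def algebra_simps)
          moreover have "\<bar>jr * (of_int n * \<alpha> - of_int p)\<bar> = jr * \<delta>" using jr by (simp add: abs_mult \<delta>_def)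
          ultimately have "\<parallel>of_int s * \<alpha>\<parallel> - jr * \<delta> \<le> \<parallel>of_int t * \<alpha>\<parallel>"
            using dist_nearest_int_add_ge[of "of_int s * \<alpha>" "jr * (of_int n * \<alpha> - of_int p)"] by simp
          then have low: "1 / (128 * mr) - 1 / (512 * mr) - 1 / (512 * mr) \<le> \<parallel>of_int i * \<alpha> - \<beta>'\<parallel>"
            using Ds j\<delta>' ym ty by linarith
          define w where "w = 1 / (512 * mr)"
          have w: "1 / (128 * mr) = 4 * w" "1 / (512 * mr) = w" "1 / (256 * mr) = 2 * w" by (simp_all add: w_def)
          have D256: "1 / (256 * mr) \<le> \<parallel>of_int i * \<alpha> - \<beta>'\<parallel>" using low unfolding w by linarith
          have "c \<le> c' / 2048" using c' c by linarith
          also have "\<dots> = c' * mr / 8 * (1 / (256 * mr))" using mr by simp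
          also have "\<dots> \<le> of_int i * \<parallel>of_int i * \<alpha> - \<beta>'\<parallel>" using large D256 ir mr by (intro mult_mono) auto
          finally show ?thesis .
        qed
      qed
    qed
  qed
  \<comment> \<open>The level c' is regained only at distance N after the hit; in between,
    \<parallel>t\<alpha>\<parallel> \<ge> \<delta> with weight at least jn secures the level
    c.\<close>
  define Q' where "Q' = nat q + nat \<lceil>N\<rceil>"
  have nq: "real (nat q) = of_int q" "int (nat q) = q" using q0 by auto
  have Nc: "1 \<le> nat \<lceil>N\<rceil>" using N1 by linarith
  have "extends_by_hit \<alpha> c' c \<eta> \<beta> Q \<beta>' (nat q) Q'"
    unfolding extends_by_hit_def avoids_from_def
  proof (intro conjI allI impI ballI)
    show "\<bar>\<beta>' - \<beta>\<bar> < \<eta>" using dist m_large by linarith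
    have "real Q \<le> of_int q" using nr q0 by linarith
    then show "Q \<le> nat q" by linarith
    show "nat q < Q'" using Nc unfolding Q'_def by linarith
    show "\<bar>real (nat q) * \<parallel>real (nat q) * \<alpha> - \<beta>'\<parallel> - c\<bar> < \<eta>" unfolding nq(1) hit using qy \<kappa> by linarith
    show "c' \<le> real i * \<parallel>real i * \<alpha> - \<beta>'\<parallel>" if iQ: "Q' \<le> i" for i
    proof -
      have "q + \<lceil>N\<rceil> \<le> int i" using iQ nq(2) unfolding Q'_def by linarith
      then have "q < int i" "N \<le> of_int (int i - q)" using N1 by linarith+
      from future(2)[OF this] show ?thesis by simp
    qed
  next
    fix i assume i: "i \<in> {Q..<Q'} - {nat q}"
    show "c \<le> real i * \<parallel>real i * \<alpha> - \<beta>'\<parallel>"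
    proof (cases "i = 0")
      case True
      then have "Q \<le> 0" using i by simp
      from av[unfolded avoids_from_def, rule_format, OF this] show ?thesis using avoidance by simp
    next
      case False
      then have i0: "0 < int i" "int Q \<le> int i" "int i \<noteq> q" using i by auto
      show ?thesis
      proof (cases "int i < q")
        case True
        from past[OF i0(2,1) True] show ?thesis by simp
      next
        case False
        then have "q < int i" using i0 by simp
        from future(1)[OF this] show ?thesis by simp
      qed
    qed
  qed
  then show ?thesis unfolding c'_def by blast
qed

lemma interval_subset_S_plus: "{0..ereal (avoidance / 4096)} \<subseteq> S_plus \<alpha>"
proof -
  obtain x where "\<And>t::int. 1 \<le> real_of_int t \<Longrightarrow> ((1 / 1024) / 20)\<^sup>2 / 80 \<le> of_int t * \<parallel>of_int t * \<alpha> - x\<parallel>"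
    by (rule avoiding_point_in_interval_general[of "1 / 1024" 1 \<alpha> 0]) auto
  then have x: "\<And>t::int. 1 \<le> real_of_int t \<Longrightarrow> avoidance \<le> of_int t * \<parallel>of_int t * \<alpha> - x\<parallel>"
    by (simp add: avoidance_def)
  have "avoidance \<le> real i * \<parallel>real i * \<alpha> - x\<parallel>" if "1 \<le> i" for i
    using x[of "int i"] that by simp
  then have start: "avoids_from \<alpha> avoidance x 1" by (simp add: avoids_from_def)
  show ?thesis
    by (rule interval_subset_S_plus_if_extensions[OF _ start extension_exists]) (use avoidance in simp)
qed

end

theorem theorem1p1:
  fixes \<alpha> :: real
  assumes "\<alpha> \<notin> \<rat>"
  shows "\<exists>\<mu>::real. \<mu> > 0 \<and> {0..ereal \<mu>} \<subseteq> S_plus \<alpha>"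
proof (cases "\<exists>\<kappa>>0. \<forall>t::int. 1 \<le> t \<longrightarrow> \<kappa> \<le> of_int t * \<parallel>of_int t * \<alpha>\<parallel>")
  case True
  then obtain \<kappa> where \<kappa>: "\<kappa> > 0" "\<And>t::int. 1 \<le> t \<Longrightarrow> \<kappa> \<le> of_int t * \<parallel>of_int t * \<alpha>\<parallel>" by blast
  interpret badly_approximable \<alpha> \<kappa>
  proof
    fix t :: int assume "t \<noteq> 0"
    then show "\<kappa> \<le> \<bar>of_int t\<bar> * \<parallel>of_int t * \<alpha>\<parallel>"
      using \<kappa>(2)[of t] \<kappa>(2)[of "- t"] by (cases "0 < t") auto
  qed (rule \<kappa>)
  show ?thesis using interval_subset_S_plus kappa_pos by (intro exI[of _ "\<kappa> ^ 3 / 10 ^ 10"]) simp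
next
  case False
  interpret well_approximable \<alpha>
    by unfold_locales (use assms False in \<open>auto simp: not_le\<close>)
  show ?thesis using interval_subset_S_plus avoidance(1) by (intro exI[of _ "avoidance / 4096"]) simp
qed

end
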